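(* Let $\mu,\nu$ be probability measures on $\mathbb{R}$ with finite first moments, both absolutely continuous with respect to Lebesgue measure. Let $\theta$ be a strictly convex cost function. Assume there is a coupling of $\mu$ and $\nu$ for which the weak transport cost is finite. Then $$\overline{\mathcal{T}}_\theta(\nu|\mu)=\mathcal{T}_\theta(\mu,\nu)$$ holds if and only if the function $u\mapsto F_\mu^{-1}(u)-F_\nu^{-1}(u)$ is non-decreasing on $(0,1)$.
   Context: A cost function is an even convex function $\theta:\mathbb{R}\to[0,\infty)$ with $\theta(0)=0$. For probability measures $\mu,\nu$ with finite first moments: - The weak transport cost is $\overline{\mathcal{T}}_\theta(\nu|\mu)=\inf_\pi\int\theta\big(|x-\int y\,p(x,dy)|\big)\,\mu(dx)$. The infimum runs over all couplings $\pi(dx\,dy)=\mu(dx)p(x,dy)$ of $\mu$ (first marginal) and $\nu$ (second marginal), where $p$ is the disintegration kernel with respect to the first marginal. - The classical transport cost is $\mathcal{T}_\theta(\mu,\nu)=\inf_\pi\int\theta(|x-y|)\,d\pi(x,y)$. $F_\mu(x)=\mu((-\infty,x])$ is the cumulative distribution function, and $F_\mu^{-1}(u)=\inf\{x\in\mathbb{R}: F_\mu(x)\ge u\}$ is its generalized inverse. *)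

theory Defs
  imports "HOL-Probability.Probability"
begin

definition cost_function :: "(real \<Rightarrow> real) \<Rightarrow> bool" where
  "cost_function \<theta> \<longleftrightarrow> (\<forall>x. \<theta> (- x) = \<theta> x) \<and> convex_on UNIV \<theta> \<and> (\<forall>x. 0 \<le> \<theta> x) \<and> \<theta> 0 = 0"

definition strictly_convex :: "(real \<Rightarrow> real) \<Rightarrow> bool" where
  "strictly_convex \<theta> \<longleftrightarrow>
     (\<forall>x y t. x \<noteq> y \<longrightarrow> 0 < t \<longrightarrow> t < 1 \<longrightarrow>
        \<theta> (t * x + (1 - t) * y) < t * \<theta> x + (1 - t) * \<theta> y)"

definition prob_fm :: "real measure \<Rightarrow> bool" where
  "prob_fm \<mu> \<longleftrightarrow> prob_space \<mu> \<and> sets \<mu> = sets borel \<and> integrable \<mu> (\<lambda>x. x)"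

definition couplings :: "real measure \<Rightarrow> real measure \<Rightarrow> (real \<times> real) measure set" where
  "couplings \<mu> \<nu> = {\<pi>. prob_space \<pi> \<and> sets \<pi> = sets (borel \<Otimes>\<^sub>M borel) \<and>
      distr \<pi> borel fst = \<mu> \<and> distr \<pi> borel snd = \<nu>}"

text \<open>Couplings written via their disintegration kernel w.r.t. the first marginal:
  \<pi>(dx dy) = \<mu>(dx) p(x,dy); the second marginal of this coupling is bind \<mu> p.\<close>
definition coupling_kernels :: "real measure \<Rightarrow> real measure \<Rightarrow> (real \<Rightarrow> real measure) set" where
  "coupling_kernels \<mu> \<nu> = {p. p \<in> borel \<rightarrow>\<^sub>M prob_algebra borel \<and> bind \<mu> p = \<nu>}"

definition weak_cost_of :: "(real \<Rightarrow> real) \<Rightarrow> real measure \<Rightarrow> (real \<Rightarrow> real measure) \<Rightarrow> ennreal" where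
  "weak_cost_of \<theta> \<mu> p = (\<integral>\<^sup>+ x. ennreal (\<theta> \<bar>x - (\<integral> y. y \<partial>(p x))\<bar>) \<partial>\<mu>)"

definition weak_transport_cost :: "(real \<Rightarrow> real) \<Rightarrow> real measure \<Rightarrow> real measure \<Rightarrow> ennreal" where
  "weak_transport_cost \<theta> \<nu> \<mu> = (INF p \<in> coupling_kernels \<mu> \<nu>. weak_cost_of \<theta> \<mu> p)"

definition transport_cost :: "(real \<Rightarrow> real) \<Rightarrow> real measure \<Rightarrow> real measure \<Rightarrow> ennreal" where
  "transport_cost \<theta> \<mu> \<nu> = (INF \<pi> \<in> couplings \<mu> \<nu>. \<integral>\<^sup>+ z. ennreal (\<theta> \<bar>fst z - snd z\<bar>) \<partial>\<pi>)"

definition cdf :: "real measure \<Rightarrow> real \<Rightarrow> real" where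
  "cdf \<mu> x = measure \<mu> {..x}"

definition quantile :: "real measure \<Rightarrow> real \<Rightarrow> real" where
  "quantile \<mu> u = Inf {x. cdf \<mu> x \<ge> u}"

end

theory Submission
  imports Defs
begin

text \<open>
  Write \<open>X\<close> and \<open>Y\<close> for the quantile functions of \<open>\<mu>\<close> and \<open>\<nu>\<close> on \<open>(0,1)\<close>, and \<open>C\<close> for the cost
  \<open>\<integral> \<theta> (X u - Y u) du\<close> of the monotone coupling. Both lower bounds come from Kantorovich potentials
  \<open>\<phi> x - P y \<le> \<theta> (x - y)\<close> with equality at \<open>(X u, Y u)\<close>, where the slope of \<open>P\<close> at \<open>Y u\<close> is a
  subgradient of \<open>\<theta>\<close> at \<open>X u - Y u\<close>. Making \<open>\<theta>\<close> linear outside \<open>[-N, N]\<close> renders the potentials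
  Lipschitz, hence integrable, and \<open>N \<rightarrow> \<infinity>\<close> follows by Fatou. So the transport cost is always \<open>C\<close>.
  If \<open>X - Y\<close> is non-decreasing, then \<open>P\<close> can be chosen convex and Jensen's inequality
  \<open>P (\<integral> y p(x,dy)) \<le> \<integral> P y p(x,dy)\<close> gives the same bound for the weak cost.
  If \<open>X - Y\<close> decreases somewhere, it decreases by translation from a short interval \<open>I\<close> to an interval
  \<open>J\<close>; exchanging part of the mass between \<open>u \<in> I\<close> and its translate replaces both displacements by
  their mean, which strictly lowers the cost by strict convexity.
\<close>

subsection \<open>Subgradients and Lipschitz truncation\<close>

text \<open>\<open>\<theta>\<close> need not be differentiable, so a choice \<open>g\<close> of one
  subgradient at every point stands in for the derivative throughout.\<close>

definition subgradient :: "(real \<Rightarrow> real) \<Rightarrow> (real \<Rightarrow> real) \<Rightarrow> bool" where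
  "subgradient f g \<longleftrightarrow> (\<forall>a b. f a + g a * (b - a) \<le> f b)"

lemma subgradientD: "subgradient f g \<Longrightarrow> f a + g a * (b - a) \<le> f b"
  by (simp add: subgradient_def)

lemma convex_on_UNIV_subgradient_exists:
  assumes "convex_on UNIV f"
  obtains g where "subgradient f g"
  using convex_le_Inf_differential[OF assms]
  by (auto simp: subgradient_def intro!: that)

lemma subgradient_mono:
  assumes "subgradient f g"
  shows "mono g"
proof
  fix a b :: real assume "a \<le> b"
  show "g a \<le> g b"
  proof (cases "a = b")
    case False
    with \<open>a \<le> b\<close> have "0 < b - a" by simp
    have "g a * (b - a) \<le> g b * (b - a)"
      using subgradientD[OF assms, of a b] subgradientD[OF assms, of b a] by (simp add: algebra_simps)
    then show ?thesis using \<open>0 < b - a\<close> by simp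
  qed simp
qed

lemma subgradient_lipschitz:
  assumes "subgradient f g" "\<And>a. \<bar>g a\<bar> \<le> L"
  shows "\<bar>f b - f a\<bar> \<le> L * \<bar>b - a\<bar>"
proof -
  have *: "f a - f b \<le> L * \<bar>b - a\<bar>" for a b
  proof -
    have "f a - f b \<le> - (g a * (b - a))"
      using subgradientD[OF assms(1), of a b] by simp
    also have "\<dots> \<le> \<bar>g a\<bar> * \<bar>b - a\<bar>"
      by (metis abs_ge_minus_self abs_mult)
    also have "\<dots> \<le> L * \<bar>b - a\<bar>"
      by (intro mult_right_mono assms) auto
    finally show ?thesis .
  qed
  show ?thesis using *[of a b] *[of b a] by (auto simp: abs_minus_commute)
qed

section \<open>Fundamental theorem of calculus for convex functions\<close>

text \<open>Cut \<open>[a, b]\<close> into \<open>n + 1\<close> pieces of length \<open>h\<close>: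
  the increments of \<open>g\<close> telescope, so the bounds add up to
  \<open>(g b - g a) * h\<close>, and \<open>h\<close> tends to \<open>0\<close>.\<close>

lemma constant_if_increment_small:
  fixes D g :: "real \<Rightarrow> real"
  assumes "a \<le> b"
    and inc: "\<And>s t. a \<le> s \<Longrightarrow> s \<le> t \<Longrightarrow> t \<le> b \<Longrightarrow> \<bar>D t - D s\<bar> \<le> (g t - g s) * (t - s)"
  shows "D b = D a"
proof -
  have bound: "\<bar>D b - D a\<bar> \<le> (g b - g a) * (b - a) / real (Suc n)" for n
  proof -
    define h where "h = (b - a) / real (Suc n)"
    define x where "x i = a + real i * h" for i :: nat
    have h: "0 \<le> h" using \<open>a \<le> b\<close> by (simp add: h_def)
    have x0: "x 0 = a" by (simp add: x_def)
    have xn: "x (Suc n) = b" unfolding x_def h_def by (simp del: of_nat_Suc)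
    have step: "\<bar>D (x (Suc i)) - D (x i)\<bar> \<le> (g (x (Suc i)) - g (x i)) * h" if "i \<le> n" for i
    proof -
      have d: "x (Suc i) - x i = h" by (simp add: x_def algebra_simps)
      have "x (Suc i) \<le> x (Suc n)"
        unfolding x_def using that h by (intro add_left_mono mult_right_mono) auto
      moreover have "a \<le> x i" using h by (simp add: x_def)
      ultimately show ?thesis using inc[of "x i" "x (Suc i)"] d h xn by auto
    qed
    have "\<bar>D b - D a\<bar> = \<bar>\<Sum>i<Suc n. D (x (Suc i)) - D (x i)\<bar>"
      by (simp only: sum_lessThan_telescope[where f="\<lambda>i. D (x i)"] x0 xn)
    also have "\<dots> \<le> (\<Sum>i<Suc n. \<bar>D (x (Suc i)) - D (x i)\<bar>)" by (rule sum_abs)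
    also have "\<dots> \<le> (\<Sum>i<Suc n. (g (x (Suc i)) - g (x i)) * h)"
      by (intro sum_mono step) auto
    also have "\<dots> = (g b - g a) * h"
      by (simp only: sum_distrib_right[symmetric] sum_lessThan_telescope[where f="\<lambda>i. g (x i)"] x0 xn)
    finally show ?thesis by (simp add: h_def)
  qed
  have "(\<lambda>n. (g b - g a) * (b - a) / real (Suc n)) \<longlonglongrightarrow> 0"
    by (rule LIMSEQ_Suc[OF lim_const_over_n])
  then have "\<bar>D b - D a\<bar> \<le> 0"
    by (rule LIMSEQ_le_const) (use bound in auto)
  then show ?thesis by simp
qed

text \<open>Over \<open>[s, t]\<close> both the increment of \<open>f\<close> and the integral of
  \<open>g\<close> lie between \<open>g s * (t - s)\<close> and \<open>g t * (t - s)\<close>, so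
  \<open>constant_if_increment_small\<close> applies to their difference.\<close>

lemma subgradient_has_integral:
  assumes sg: "subgradient f g" and ab: "a \<le> b"
  shows "(g has_integral (f b - f a)) {a..b}"
proof -
  have m: "mono g" using sg by (rule subgradient_mono)
  have int: "g integrable_on {s..t}" for s t
    by (intro integrable_on_mono_on) (use m in \<open>auto simp: mono_on_def mono_def\<close>)
  define D where "D t = f t - integral {a..t} g" for t
  have "D b = D a"
  proof (rule constant_if_increment_small[OF ab, of D g])
    fix s t assume st: "a \<le> s" "s \<le> t" "t \<le> b"
    have c: "integral {a..t} g = integral {a..s} g + integral {s..t} g"
      using Henstock_Kurzweil_Integration.integral_combine[of a s t g] st int by simp
    have "integral {s..t} (\<lambda>_. g s) \<le> integral {s..t} g"
      by (intro integral_le int) (use m in \<open>auto simp: mono_def\<close>)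
    moreover have "integral {s..t} g \<le> integral {s..t} (\<lambda>_. g t)"
      by (intro integral_le int) (use m in \<open>auto simp: mono_def\<close>)
    ultimately have "g s * (t - s) \<le> integral {s..t} g" "integral {s..t} g \<le> g t * (t - s)"
      using st by (simp_all add: mult.commute)
    moreover have "f s + g s * (t - s) \<le> f t" "f t + g t * (s - t) \<le> f s"
      using sg by (auto dest: subgradientD)
    ultimately show "\<bar>D t - D s\<bar> \<le> (g t - g s) * (t - s)"
      unfolding D_def c by (auto simp: algebra_simps abs_le_iff)
  qed
  then have "integral {a..b} g = f b - f a" by (simp add: D_def)
  then show ?thesis using int[of a b] by (simp add: has_integral_iff)
qed

section \<open>Linear continuation outside a bounded interval\<close>

definition clamp_real :: "real \<Rightarrow> real \<Rightarrow> real" where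
  "clamp_real N t = max (- N) (min N t)"

text \<open>Beyond \<open>N\<close> and \<open>- N\<close> the graph continues along a tangent line.
  If \<open>g\<close> is a subgradient of \<open>f\<close>, this yields convex minorants of bounded
  slope that agree with \<open>f\<close> on growing intervals.\<close>

definition linear_cutoff :: "(real \<Rightarrow> real) \<Rightarrow> (real \<Rightarrow> real) \<Rightarrow> real \<Rightarrow> real \<Rightarrow> real" where
  "linear_cutoff f g N t = f (clamp_real N t) + g (clamp_real N t) * (t - clamp_real N t)"

lemma linear_cutoff_le: "subgradient f g \<Longrightarrow> linear_cutoff f g N t \<le> f t"
  unfolding linear_cutoff_def by (rule subgradientD)

lemma clamp_real_id: "\<bar>t\<bar> \<le> N \<Longrightarrow> clamp_real N t = t"
  by (auto simp: clamp_real_def)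

lemma linear_cutoff_eq: "\<bar>t\<bar> \<le> N \<Longrightarrow> linear_cutoff f g N t = f t"
  by (simp add: linear_cutoff_def clamp_real_id)

lemma subgradient_linear_cutoff:
  assumes sg: "subgradient f g" and N: "0 \<le> N"
  shows "subgradient (linear_cutoff f g N) (\<lambda>t. g (clamp_real N t))"
  unfolding subgradient_def
proof (intro allI)
  fix a b
  let ?a = "clamp_real N a" and ?b = "clamp_real N b"
  have m: "mono g" using sg by (rule subgradient_mono)
  \<comment> \<open>If \<open>b\<close> lies outside \<open>[- N, N]\<close>, then \<open>?b\<close>
    is the nearer endpoint, so by monotonicity of \<open>g\<close> the two factors do not have
    opposite signs.\<close>
  have "0 \<le> (g ?b - g ?a) * (b - ?b)"
  proof (cases "b < - N \<or> N < b")
    case True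
    then show ?thesis
      using N m by (auto simp: clamp_real_def min_def max_def mono_def intro!: mult_nonneg_nonneg mult_nonpos_nonpos)
  next
    case False
    then have "?b = b" by (auto simp: clamp_real_def)
    then show ?thesis by simp
  qed
  moreover have "f ?a + g ?a * (?b - ?a) \<le> f ?b" using sg by (rule subgradientD)
  ultimately show "linear_cutoff f g N a + g ?a * (b - a) \<le> linear_cutoff f g N b"
    unfolding linear_cutoff_def by (simp add: algebra_simps)
qed

text \<open>Since \<open>0\<close> is a minimum of \<open>f\<close>, the tangent lines attached at
  \<open>N\<close> and \<open>- N\<close> do not descend outwards.\<close>

lemma linear_cutoff_nonneg:
  assumes sg: "subgradient f g" and N: "0 < N" and f: "\<And>t. 0 \<le> f t" "f 0 = 0"
  shows "0 \<le> linear_cutoff f g N t"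
proof -
  let ?c = "clamp_real N t"
  have le: "0 \<le> g ?c * ?c"
    using subgradientD[OF sg, of ?c 0] f(1)[of ?c] f(2) by simp
  have "0 \<le> g ?c * (t - ?c)"
  proof (cases "t < - N \<or> N < t")
    case True
    then show ?thesis using N le
      by (auto simp: clamp_real_def min_def max_def zero_le_mult_iff mult_le_0_iff)
  next
    case False
    then have "?c = t" by (auto simp: clamp_real_def)
    then show ?thesis by simp
  qed
  then show ?thesis using f(1)[of ?c] by (simp add: linear_cutoff_def)
qed

lemma linear_cutoff_slope_bounded:
  assumes "subgradient f g" "0 \<le> N"
  shows "\<bar>g (clamp_real N t)\<bar> \<le> max \<bar>g N\<bar> \<bar>g (- N)\<bar>"
proof -
  have "- N \<le> clamp_real N t" "clamp_real N t \<le> N" using assms(2) by (auto simp: clamp_real_def)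
  then have "g (- N) \<le> g (clamp_real N t)" "g (clamp_real N t) \<le> g N"
    using subgradient_mono[OF assms(1)] by (auto simp: mono_def)
  then show ?thesis by auto
qed

lemma antiderivative_exists:
  fixes G :: "real \<Rightarrow> real"
  assumes "G \<in> borel_measurable borel" "\<And>w. \<bar>G w\<bar> \<le> L"
  obtains P where "\<And>a b. a \<le> b \<Longrightarrow> (G has_integral (P b - P a)) {a..b}"
proof -
  have int: "G integrable_on {a..b}" for a b
  proof -
    have "set_integrable lborel {a..b} G"
      unfolding set_integrable_def using assms
      by (intro integrableI_bounded_set_indicator[where B=L]) (auto simp: emeasure_lborel_Icc_eq)
    then show ?thesis by (rule set_borel_integral_eq_integral)
  qed
  \<comment> \<open>The integral over \<open>{0..y}\<close> is \<open>0\<close> for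
    \<open>y < 0\<close>, so the orientation is handled by cases.\<close>
  define P where "P y = (if 0 \<le> y then integral {0..y} G else - integral {y..0} G)" for y
  show ?thesis
  proof
    fix a b :: real assume "a \<le> b"
    have "P b - P a = integral {a..b} G"
      using \<open>a \<le> b\<close> Henstock_Kurzweil_Integration.integral_combine[OF _ _ int, of 0 a b]
        Henstock_Kurzweil_Integration.integral_combine[OF _ _ int, of a 0 b]
        Henstock_Kurzweil_Integration.integral_combine[OF _ _ int, of a b 0]
      unfolding P_def by (auto simp: not_le)
    then show "(G has_integral (P b - P a)) {a..b}"
      using int[of a b] by (simp add: has_integral_iff)
  qed
qed

subsection \<open>Potentials, quantiles and kernels\<close>

abbreviation U01 :: "real measure" where
  "U01 \<equiv> restrict_space lborel {0<..<1}"

lemma prob_space_U01: "prob_space U01"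
  by (auto simp: emeasure_restrict_space space_restrict_space intro!: prob_spaceI)

lemma lipschitz_on_borel_measurable:
  fixes f :: "real \<Rightarrow> real"
  shows "L-lipschitz_on UNIV f \<Longrightarrow> f \<in> borel_measurable borel"
  by (intro borel_measurable_continuous_onI lipschitz_on_continuous_on)

lemma (in finite_measure) integrable_lipschitz:
  fixes f h :: "_ \<Rightarrow> real"
  assumes f: "L-lipschitz_on UNIV f" and h: "integrable M h"
  shows "integrable M (\<lambda>x. f (h x))"
proof (rule Bochner_Integration.integrable_bound)
  have [measurable]: "f \<in> borel_measurable borel" using f by (rule lipschitz_on_borel_measurable)
  have [measurable]: "h \<in> borel_measurable M" using h by simp
  show "(\<lambda>x. f (h x)) \<in> borel_measurable M" by measurable
  show "integrable M (\<lambda>x. \<bar>f 0\<bar> + L * \<bar>h x\<bar>)"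
    using h by auto
  show "AE x in M. norm (f (h x)) \<le> norm (\<bar>f 0\<bar> + L * \<bar>h x\<bar>)"
  proof (intro AE_I2)
    fix x
    have "\<bar>f (h x) - f 0\<bar> \<le> L * \<bar>h x\<bar>"
      using lipschitz_onD[OF f, of "h x" 0] by (simp add: dist_real_def)
    then show "norm (f (h x)) \<le> norm (\<bar>f 0\<bar> + L * \<bar>h x\<bar>)" by simp
  qed
qed

lemma subgradient_lipschitz_on:
  assumes "subgradient f g" "\<And>a. \<bar>g a\<bar> \<le> L"
  shows "L-lipschitz_on UNIV f"
proof (rule lipschitz_onI)
  show "0 \<le> L" using assms(2)[of 0] by simp
qed (use subgradient_lipschitz[OF assms] in \<open>simp add: dist_real_def\<close>)

lemma antiderivative_lipschitz_on:
  fixes G P :: "real \<Rightarrow> real"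
  assumes P: "\<And>a b. a \<le> b \<Longrightarrow> (G has_integral (P b - P a)) {a..b}"
    and G: "\<And>w. \<bar>G w\<bar> \<le> L"
  shows "L-lipschitz_on UNIV P"
proof (rule lipschitz_onI)
  show "0 \<le> L" using G[of 0] by simp
  have *: "\<bar>P b - P a\<bar> \<le> L * (b - a)" if "a \<le> b" for a b
    using has_integral_bound_real[OF \<open>0 \<le> L\<close> finite.emptyI P[OF that]] G that by auto
  show "dist (P a) (P b) \<le> L * dist a b" for a b
    using *[of a b] *[of b a] by (cases "a \<le> b") (auto simp: dist_real_def abs_minus_commute)
qed

text \<open>A counterpart of \<open>subgradient_has_integral\<close>: a monotone slope makes its
  antiderivative convex, as Jensen's inequality later requires.\<close>

lemma antiderivative_convex_tangent:
  fixes G P :: "real \<Rightarrow> real"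
  assumes P: "\<And>a b. a \<le> b \<Longrightarrow> (G has_integral (P b - P a)) {a..b}" and "mono G"
  shows "subgradient P G"
  unfolding subgradient_def
proof (intro allI)
  fix a b
  show "P a + G a * (b - a) \<le> P b"
  proof (cases "a \<le> b")
    case True
    have "((\<lambda>_. G a) has_integral (G a * (b - a))) {a..b}"
      using has_integral_const_real[of "G a" a b] True by (simp add: mult.commute)
    from has_integral_le[OF this P[OF True]] show ?thesis
      using \<open>mono G\<close> by (auto simp: mono_def)
  next
    case False
    have "((\<lambda>_. G a) has_integral (G a * (a - b))) {b..a}"
      using has_integral_const_real[of "G a" b a] False by (simp add: mult.commute)
    from has_integral_le[OF P this] show ?thesis
      using \<open>mono G\<close> False by (auto simp: mono_def algebra_simps)
  qed
qed

text \<open>As a function of \<open>z\<close>, the right-hand side has slope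
  \<open>G z - g (x - z)\<close>, which passes from nonpositive to nonnegative at
  \<open>y\<close>.\<close>

lemma potential_minimum:
  fixes G P :: "real \<Rightarrow> real"
  assumes sg: "subgradient f g"
    and P: "\<And>a b. a \<le> b \<Longrightarrow> (G has_integral (P b - P a)) {a..b}"
    and hi: "\<And>w. y \<le> w \<Longrightarrow> g (x - w) \<le> G w"
    and lo: "\<And>w. w < y \<Longrightarrow> G w \<le> g (x - w)"
  shows "f (x - y) + P y \<le> f (x - z) + P z"
proof -
  have "subgradient (\<lambda>w. f (x - w)) (\<lambda>w. - g (x - w))"
    unfolding subgradient_def
  proof (intro allI)
    fix a b
    show "f (x - a) + - g (x - a) * (b - a) \<le> f (x - b)"
      using subgradientD[OF sg, of "x - a" "x - b"] by (simp add: algebra_simps)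
  qed
  then have f: "((\<lambda>w. g (x - w)) has_integral (f (x - a) - f (x - b))) {a..b}" if "a \<le> b" for a b
    using has_integral_neg[OF subgradient_has_integral, of _ _ a b] that by fastforce
  show ?thesis
  proof (cases "y \<le> z")
    case True
    from has_integral_le[OF f[OF this] P[OF this]] show ?thesis using hi by auto
  next
    case False
    then have zy: "z \<le> y" by simp
    \<comment> \<open>\<open>lo\<close> is silent at \<open>w = y\<close>, so \<open>G\<close> is
      altered at this single point, which leaves its integral unchanged.\<close>
    have "((\<lambda>w. if w = y then g (x - y) else G w) has_integral (P y - P z)) {z..y}"
      by (rule has_integral_spike_finite[OF _ _ P[OF zy], of "{y}"]) auto
    from has_integral_le[OF this f[OF zy]] show ?thesis using lo by force
  qed
qed

text \<open>\<open>\<phi>\<close> is the infimal convolution of \<open>f\<close> and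
  \<open>P\<close>. A minimum at the single point \<open>x0\<close>, together with the Lipschitz
  bound, keeps the infimum finite at every \<open>x\<close>.\<close>

lemma conjugate_potential:
  fixes f P :: "real \<Rightarrow> real"
  assumes f: "L-lipschitz_on UNIV f"
    and ex: "\<And>z. f (x0 - y0) + P y0 \<le> f (x0 - z) + P z"
  obtains \<phi> where "L-lipschitz_on UNIV \<phi>" "\<And>x y. \<phi> x \<le> f (x - y) + P y"
    "\<And>x y. \<forall>z. f (x - y) + P y \<le> f (x - z) + P z \<Longrightarrow> \<phi> x = f (x - y) + P y"
proof
  define \<phi> where "\<phi> x = (INF y. f (x - y) + P y)" for x
  have near: "f (x' - y) \<le> f (x - y) + L * \<bar>x - x'\<bar>" for x x' y
    using lipschitz_onD[OF f, of "x' - y" "x - y"] by (simp add: dist_real_def abs_minus_commute)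
  have bdd: "bdd_below (range (\<lambda>y. f (x - y) + P y))" for x
  proof (rule bdd_belowI2)
    fix y
    show "f (x0 - y0) + P y0 - L * \<bar>x - x0\<bar> \<le> f (x - y) + P y"
      using ex[of y] near[of x0 y x] by simp
  qed
  show le: "\<phi> x \<le> f (x - y) + P y" for x y
    unfolding \<phi>_def by (rule cINF_lower[OF bdd]) simp
  have *: "\<phi> x' - L * \<bar>x - x'\<bar> \<le> \<phi> x" for x x'
    unfolding \<phi>_def[of x]
  proof (rule cINF_greatest)
    fix y
    show "\<phi> x' - L * \<bar>x - x'\<bar> \<le> f (x - y) + P y"
      using le[of x' y] near[of x' y x] by simp
  qed simp
  show "L-lipschitz_on UNIV \<phi>"
  proof (rule lipschitz_onI)
    show "dist (\<phi> a) (\<phi> b) \<le> L * dist a b" for a b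
      using *[of a b] *[of b a] by (auto simp: dist_real_def abs_minus_commute)
  qed (rule lipschitz_on_nonneg[OF f])
  show "\<phi> x = f (x - y) + P y" if "\<forall>z. f (x - y) + P y \<le> f (x - z) + P z" for x y
  proof (rule antisym[OF le])
    show "f (x - y) + P y \<le> \<phi> x"
      unfolding \<phi>_def by (rule cINF_greatest) (use that in auto)
  qed
qed

section \<open>Quantile functions\<close>

lemma (in real_distribution) quantile_facts:
  shows quantile_le_iff: "0 < u \<Longrightarrow> u < 1 \<Longrightarrow> quantile M u \<le> x \<longleftrightarrow> u \<le> Defs.cdf M x"
    and distr_quantile: "distr U01 borel (quantile M) = M"
    and quantile_measurable: "quantile M \<in> borel_measurable U01"
    and mono_cdf: "mono (Defs.cdf M)"
proof -
  interpret cdf_distribution M by unfold_locales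
  have c: "Defs.cdf M = Distribution_Functions.cdf M"
    by (simp add: fun_eq_iff Defs.cdf_def Distribution_Functions.cdf_def)
  have q: "quantile M = I" by (simp add: fun_eq_iff quantile_def c)
  show "0 < u \<Longrightarrow> u < 1 \<Longrightarrow> quantile M u \<le> x \<longleftrightarrow> u \<le> Defs.cdf M x"
    using pseudoinverse[of u x] by (simp add: q c)
  show "distr U01 borel (quantile M) = M" unfolding q by (rule distr_I_eq_M)
  show "mono (Defs.cdf M)" unfolding c by (rule mono)
  show "quantile M \<in> borel_measurable U01" unfolding q
    by (subst measurable_cong_sets[OF sets_restrict_space_cong[OF sets_lborel] refl]) (rule measurable_CI)
qed

text \<open>Measurability of \<open>quantile M\<close> is available on the unit interval;
  compositions with maps of the whole line call for a Borel function, obtained by setting it to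
  \<open>0\<close> outside.\<close>

lemma (in real_distribution) quantile_borel_extension:
  obtains Z where "Z \<in> borel_measurable borel" "\<forall>u\<in>{0<..<1}. Z u = quantile M u"
proof
  have "(\<lambda>u. indicator {0<..<1} u *\<^sub>R quantile M u) \<in> borel_measurable lborel"
    using quantile_measurable by (subst (asm) borel_measurable_restrict_space_iff) auto
  then show "(\<lambda>u. indicator {0<..<1} u *\<^sub>R quantile M u) \<in> borel_measurable borel"
    by (simp only: measurable_cong_sets[OF sets_lborel refl])
qed auto

lemma (in real_distribution) mono_on_quantile: "mono_on {0<..<1} (quantile M)"
proof (rule mono_onI)
  fix u v :: real assume uv: "u \<in> {0<..<1}" "v \<in> {0<..<1}" "u \<le> v"
  then have "v \<le> Defs.cdf M (quantile M v)" using quantile_le_iff[of v] by auto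
  with uv show "quantile M u \<le> quantile M v" using quantile_le_iff[of u] by auto
qed

text \<open>Without an atom at the quantile the distribution function is continuous there, and its
  values to the left are at most \<open>u\<close>.\<close>

lemma (in real_distribution) cdf_quantile:
  assumes u: "0 < u" "u < 1" and atom: "measure M {quantile M u} = 0"
  shows "Defs.cdf M (quantile M u) = u"
proof (rule antisym)
  show "u \<le> Defs.cdf M (quantile M u)" using quantile_le_iff[OF u] by blast
  have c: "Defs.cdf M = Distribution_Functions.cdf M"
    by (simp add: fun_eq_iff Defs.cdf_def Distribution_Functions.cdf_def)
  have "isCont (Defs.cdf M) (quantile M u)"
    unfolding c using atom by (simp add: isCont_cdf)
  then have "(Defs.cdf M \<longlongrightarrow> Defs.cdf M (quantile M u)) (at_left (quantile M u))"
    by (simp add: isCont_def filterlim_at_split)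
  moreover have "\<forall>\<^sub>F x in at_left (quantile M u). Defs.cdf M x \<le> u"
    unfolding eventually_at_left_field
    by (rule exI[of _ "quantile M u - 1"], simp) (metis quantile_le_iff[OF u] linear not_le)
  ultimately show "Defs.cdf M (quantile M u) \<le> u"
    by (rule tendsto_upperbound) simp
qed

lemma prob_fm_real_distribution: "prob_fm \<mu> \<Longrightarrow> real_distribution \<mu>"
  by (simp add: prob_fm_def real_distribution_def real_distribution_axioms_def sets_eq_imp_space_eq)

section \<open>Fubini's theorem for kernels\<close>

text \<open>The total integral is finite, so by Tonelli almost every inner integral is finite, and
  \<open>ennreal\<close> integrals may be read as real ones.\<close>

lemma integral_bind_nonneg:
  fixes f :: "real \<Rightarrow> real"
  assumes p: "p \<in> M \<rightarrow>\<^sub>M subprob_algebra borel" and f: "integrable (M \<bind> p) f" "\<And>y. 0 \<le> f y"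
    and fm: "f \<in> borel_measurable borel"
  shows "AE x in M. integrable (p x) f" "integrable M (\<lambda>x. \<integral>y. f y \<partial>p x)"
    "(\<integral>y. f y \<partial>(M \<bind> p)) = (\<integral>x. \<integral>y. f y \<partial>p x \<partial>M)"
proof -
  have sp: "sets (p x) = sets borel" if "x \<in> space M" for x
    using p that by (rule sets_kernel)
  have fp: "f \<in> borel_measurable (p x)" if "x \<in> space M" for x
    using fm sp[OF that] by (simp cong: measurable_cong_sets)
  have eq: "(\<integral>\<^sup>+y. ennreal (f y) \<partial>(M \<bind> p)) = (\<integral>\<^sup>+x. \<integral>\<^sup>+y. ennreal (f y) \<partial>p x \<partial>M)"
    by (rule nn_integral_bind[OF _ p]) (use fm in measurable)
  have val: "(\<integral>\<^sup>+y. ennreal (f y) \<partial>(M \<bind> p)) = ennreal (\<integral>y. f y \<partial>(M \<bind> p))"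
    using f by (intro nn_integral_eq_integral) auto
  have meas: "(\<lambda>x. \<integral>\<^sup>+y. ennreal (f y) \<partial>p x) \<in> borel_measurable M"
    by (rule measurable_compose[OF p nn_integral_measurable_subprob_algebra]) (use fm in measurable)
  have "AE x in M. (\<integral>\<^sup>+y. ennreal (f y) \<partial>p x) \<noteq> \<infinity>"
    by (rule nn_integral_PInf_AE[OF meas]) (use val eq in auto)
  with AE_space show ae: "AE x in M. integrable (p x) f"
    by eventually_elim (use fp f(2) in \<open>auto simp: integrable_iff_bounded less_top\<close>)
  have m2: "(\<lambda>x. \<integral>y. f y \<partial>p x) \<in> borel_measurable M"
    by (rule measurable_compose[OF p integral_measurable_subprob_algebra[OF fm]])
  have nn: "(\<integral>\<^sup>+x. ennreal (\<integral>y. f y \<partial>p x) \<partial>M) = ennreal (\<integral>y. f y \<partial>(M \<bind> p))"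
    unfolding val[symmetric] eq
    by (rule nn_integral_cong_AE) (use ae f(2) in \<open>auto elim!: eventually_mono simp: nn_integral_eq_integral\<close>)
  have nonneg: "0 \<le> (\<integral>y. f y \<partial>p x)" for x using f(2) by (simp add: integral_nonneg_AE)
  show i: "integrable M (\<lambda>x. \<integral>y. f y \<partial>p x)"
    unfolding integrable_iff_bounded using m2 nn nonneg by simp
  have "ennreal (\<integral>x. \<integral>y. f y \<partial>p x \<partial>M) = ennreal (\<integral>y. f y \<partial>(M \<bind> p))"
    unfolding nn[symmetric] by (rule nn_integral_eq_integral[symmetric]) (use i nonneg in auto)
  then show "(\<integral>y. f y \<partial>(M \<bind> p)) = (\<integral>x. \<integral>y. f y \<partial>p x \<partial>M)"
    using nonneg f(2) by (simp add: integral_nonneg_AE)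
qed

lemma integral_bind_borel:
  fixes f :: "real \<Rightarrow> real"
  assumes p: "p \<in> M \<rightarrow>\<^sub>M subprob_algebra borel" and f: "integrable (M \<bind> p) f"
    and fm: "f \<in> borel_measurable borel"
  shows "AE x in M. integrable (p x) f" "integrable M (\<lambda>x. \<integral>y. f y \<partial>p x)"
    "(\<integral>y. f y \<partial>(M \<bind> p)) = (\<integral>x. \<integral>y. f y \<partial>p x \<partial>M)"
proof -
  let ?f = "\<lambda>y. max 0 (f y)" and ?g = "\<lambda>y. max 0 (- f y)"
  have "integrable (M \<bind> p) ?f" "?f \<in> borel_measurable borel" "integrable (M \<bind> p) ?g" "?g \<in> borel_measurable borel"
    using f fm by auto
  note F = integral_bind_nonneg[OF p this(1) _ this(2)] and G = integral_bind_nonneg[OF p this(3) _ this(4)]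
  have fg: "f = (\<lambda>y. ?f y - ?g y)" by (auto simp: fun_eq_iff)
  have ae: "AE x in M. integrable (p x) ?f \<and> integrable (p x) ?g" using F(1) G(1) by simp
  then show "AE x in M. integrable (p x) f"
    by eventually_elim (subst fg, auto)
  have e: "AE x in M. (\<integral>y. f y \<partial>p x) = (\<integral>y. ?f y \<partial>p x) - (\<integral>y. ?g y \<partial>p x)"
    using ae by eventually_elim (subst fg, auto)
  have d: "integrable M (\<lambda>x. (\<integral>y. ?f y \<partial>p x) - (\<integral>y. ?g y \<partial>p x))"
    using F(2) G(2) by auto
  have m: "(\<lambda>x. \<integral>y. f y \<partial>p x) \<in> borel_measurable M"
    by (rule measurable_compose[OF p integral_measurable_subprob_algebra[OF fm]])
  show "integrable M (\<lambda>x. \<integral>y. f y \<partial>p x)"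
    by (rule integrable_cong_AE_imp[OF d m]) (use e in auto)
  have "(\<integral>y. f y \<partial>(M \<bind> p)) = (\<integral>y. ?f y \<partial>(M \<bind> p)) - (\<integral>y. ?g y \<partial>(M \<bind> p))"
    by (subst fg, rule Bochner_Integration.integral_diff) (use f in auto)
  also have "\<dots> = (\<integral>x. (\<integral>y. ?f y \<partial>p x) - (\<integral>y. ?g y \<partial>p x) \<partial>M)"
    using F(2,3) G(2,3) by simp
  also have "\<dots> = (\<integral>x. \<integral>y. f y \<partial>p x \<partial>M)"
    by (rule integral_cong_AE) (use d m e in auto)
  finally show "(\<integral>y. f y \<partial>(M \<bind> p)) = (\<integral>x. \<integral>y. f y \<partial>p x \<partial>M)" .
qed

subsection \<open>The classical transport cost\<close>

locale two_laws =
  fixes \<mu> \<nu> :: "real measure"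
  assumes mu: "prob_fm \<mu>" and nu: "prob_fm \<nu>"
begin

sublocale \<mu>: real_distribution \<mu> using mu by (rule prob_fm_real_distribution)
sublocale \<nu>: real_distribution \<nu> using nu by (rule prob_fm_real_distribution)
sublocale U: prob_space U01 by (rule prob_space_U01)

abbreviation "X \<equiv> quantile \<mu>"
abbreviation "Y \<equiv> quantile \<nu>"
abbreviation "monotone_cost \<theta> \<equiv> (\<integral>\<^sup>+u. ennreal (\<theta> (X u - Y u)) \<partial>U01)"

declare \<mu>.quantile_measurable [measurable] \<nu>.quantile_measurable [measurable]

lemma integrable_id: "integrable \<mu> (\<lambda>x. x)" "integrable \<nu> (\<lambda>x. x)"
  using mu nu by (auto simp: prob_fm_def)

lemma integrable_quantile: "integrable U01 X" "integrable U01 Y"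
  using integrable_distr[OF \<mu>.quantile_measurable, of "\<lambda>x. x"]
    integrable_distr[OF \<nu>.quantile_measurable, of "\<lambda>x. x"]
  unfolding \<mu>.distr_quantile \<nu>.distr_quantile by (simp_all only: integrable_id)

lemma nn_integral_mu: "h \<in> borel_measurable borel \<Longrightarrow> (\<integral>\<^sup>+x. h x \<partial>\<mu>) = (\<integral>\<^sup>+u. h (X u) \<partial>U01)"
  using nn_integral_distr[of X U01 borel h] by (simp add: \<mu>.distr_quantile)

text \<open>The classical and the weak bound use it with different \<open>G\<close>. By
  \<open>hi\<close> and \<open>lo\<close> the value \<open>Y u\<close> minimises
  \<open>f (X u - z) + P z\<close> over \<open>z\<close>; hence
  \<open>\<phi> (X u) = f (X u - Y u) + P (Y u)\<close>, and integrating over \<open>u\<close> gives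
  duality without a gap.\<close>

lemma dual_potentials:
  assumes sg: "subgradient f g" and gL: "\<And>t. \<bar>g t\<bar> \<le> L"
    and G: "G \<in> borel_measurable borel" and GL: "\<And>w. \<bar>G w\<bar> \<le> L"
    and hi: "\<And>u w. 0 < u \<Longrightarrow> u < 1 \<Longrightarrow> Y u \<le> w \<Longrightarrow> g (X u - w) \<le> G w"
    and lo: "\<And>u w. 0 < u \<Longrightarrow> u < 1 \<Longrightarrow> w < Y u \<Longrightarrow> G w \<le> g (X u - w)"
  obtains \<phi> P where "\<And>a b. a \<le> b \<Longrightarrow> (G has_integral (P b - P a)) {a..b}"
    "L-lipschitz_on UNIV \<phi>" "L-lipschitz_on UNIV P" "\<And>x y. \<phi> x \<le> f (x - y) + P y"
    "integral\<^sup>L \<mu> \<phi> - integral\<^sup>L \<nu> P = (\<integral>u. f (X u - Y u) \<partial>U01)"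
proof -
  obtain P where P: "\<And>a b. a \<le> b \<Longrightarrow> (G has_integral (P b - P a)) {a..b}"
    by (rule antiderivative_exists[OF G GL]) (rule that)
  have fL: "L-lipschitz_on UNIV f" using sg gL by (rule subgradient_lipschitz_on)
  have PL: "L-lipschitz_on UNIV P" using P GL by (rule antiderivative_lipschitz_on)
  have opt: "f (X u - Y u) + P (Y u) \<le> f (X u - z) + P z" if "0 < u" "u < 1" for u z
    by (rule potential_minimum[where f=f and P=P and g=g and G=G]) (use sg P hi[OF that] lo[OF that] in auto)
  \<comment> \<open>One optimal pair is needed for the infimum defining \<open>\<phi>\<close> to be
    finite; the level \<open>1/2\<close> is arbitrary.\<close>
  have half: "f (X (1/2) - Y (1/2)) + P (Y (1/2)) \<le> f (X (1/2) - z) + P z" for z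
    by (rule opt) auto
  obtain \<phi> where \<phi>: "L-lipschitz_on UNIV \<phi>" "\<And>x y. \<phi> x \<le> f (x - y) + P y"
    "\<And>x y. \<forall>z. f (x - y) + P y \<le> f (x - z) + P z \<Longrightarrow> \<phi> x = f (x - y) + P y"
    by (rule conjugate_potential[of L f "X (1/2)" "Y (1/2)" P, OF fL half]) (rule that)
  have [measurable]: "f \<in> borel_measurable borel" "P \<in> borel_measurable borel" "\<phi> \<in> borel_measurable borel"
    by (rule lipschitz_on_borel_measurable[OF fL] lipschitz_on_borel_measurable[OF PL]
        lipschitz_on_borel_measurable[OF \<phi>(1)])+
  have int: "integrable U01 (\<lambda>u. f (X u - Y u))" "integrable U01 (\<lambda>u. P (Y u))"
    by (rule U.integrable_lipschitz[OF fL Bochner_Integration.integrable_diff[OF integrable_quantile]],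
        rule U.integrable_lipschitz[OF PL integrable_quantile(2)])
  have "integral\<^sup>L \<mu> \<phi> = (\<integral>u. \<phi> (X u) \<partial>U01)"
    using integral_distr[of X U01 borel \<phi>] by (simp add: \<mu>.distr_quantile)
  also have "\<dots> = (\<integral>u. f (X u - Y u) + P (Y u) \<partial>U01)"
    by (rule Bochner_Integration.integral_cong) (auto simp: space_restrict_space intro!: \<phi>(3) allI opt)
  also have "\<dots> = (\<integral>u. f (X u - Y u) \<partial>U01) + (\<integral>u. P (Y u) \<partial>U01)"
    using int by simp
  also have "(\<integral>u. P (Y u) \<partial>U01) = integral\<^sup>L \<nu> P"
    using integral_distr[of Y U01 borel P] by (simp add: \<nu>.distr_quantile)
  finally show ?thesis by (intro that[OF P \<phi>(1) PL \<phi>(2)]) auto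
qed

lemma monotone_coupling: "distr U01 (borel \<Otimes>\<^sub>M borel) (\<lambda>u. (X u, Y u)) \<in> couplings \<mu> \<nu>"
proof -
  have "prob_space (distr U01 (borel \<Otimes>\<^sub>M borel) (\<lambda>u. (X u, Y u)))"
    by (rule U.prob_space_distr) measurable
  then show ?thesis
    by (simp add: couplings_def distr_distr comp_def \<mu>.distr_quantile \<nu>.distr_quantile)
qed

lemma coupling_lower_bound_lipschitz:
  assumes sg: "subgradient f g" and gL: "\<And>t. \<bar>g t\<bar> \<le> L" and pos: "\<And>t. 0 \<le> f t"
    and \<pi>: "\<pi> \<in> couplings \<mu> \<nu>"
  shows "monotone_cost f \<le> (\<integral>\<^sup>+z. ennreal (f (fst z - snd z)) \<partial>\<pi>)"
proof -
  define F where "F = Defs.cdf \<nu>"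
  \<comment> \<open>At \<open>w = Y u\<close> the level \<open>F w\<close> takes the role of
    \<open>u\<close>, so the slope aimed at is \<open>g (X u - Y u)\<close>. Levels \<open>0\<close>
    and \<open>1\<close> lie outside the range where \<open>X\<close> is meaningful; the extreme
    slopes \<open>- L\<close> and \<open>L\<close> keep \<open>hi\<close> and \<open>lo\<close> true
    there.\<close>
  define G where "G w = (if 1 \<le> F w then L else if F w \<le> 0 then - L else g (X (F w) - w))" for w
  have L: "0 \<le> L" using gL[of 0] by simp
  have [measurable]: "F \<in> borel_measurable borel"
    unfolding F_def by (intro borel_measurable_mono \<nu>.mono_cdf)
  have [measurable]: "g \<in> borel_measurable borel"
    by (intro borel_measurable_mono subgradient_mono[OF sg])
  obtain X' where [measurable]: "X' \<in> borel_measurable borel" and X': "\<forall>u\<in>{0<..<1}. X' u = X u"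
    by (rule \<mu>.quantile_borel_extension)
  \<comment> \<open>The last branch evaluates \<open>X\<close> only at levels strictly between
    \<open>0\<close> and \<open>1\<close>, where \<open>X'\<close> agrees with it.\<close>
  have "G = (\<lambda>w. if 1 \<le> F w then L else if F w \<le> 0 then - L else g (X' (F w) - w))"
    using X' by (auto simp: G_def fun_eq_iff)
  also have "\<dots> \<in> borel_measurable borel" by measurable
  finally have Gm: "G \<in> borel_measurable borel" .
  have GL: "\<bar>G w\<bar> \<le> L" for w using gL L by (auto simp: G_def)
  have mg: "g a \<le> g b" if "a \<le> b" for a b using subgradient_mono[OF sg] that by (rule monoD)
  obtain \<phi> P where D: "L-lipschitz_on UNIV \<phi>" "L-lipschitz_on UNIV P" "\<And>x y. \<phi> x \<le> f (x - y) + P y"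
    "integral\<^sup>L \<mu> \<phi> - integral\<^sup>L \<nu> P = (\<integral>u. f (X u - Y u) \<partial>U01)"
  proof (rule dual_potentials[OF sg gL Gm GL])
    fix u w :: real assume u: "0 < u" "u < 1"
    show "g (X u - w) \<le> G w" if "Y u \<le> w"
    proof -
      have "u \<le> F w" using \<nu>.quantile_le_iff[OF u] that by (simp add: F_def)
      moreover have "X u \<le> X (F w)" if "F w < 1"
        using mono_onD[OF \<mu>.mono_on_quantile, of u "F w"] u \<open>u \<le> F w\<close> that by auto
      ultimately show ?thesis using gL[of "X u - w"] u by (auto simp: G_def intro!: mg)
    qed
    show "G w \<le> g (X u - w)" if "w < Y u"
    proof -
      have "F w < u" using \<nu>.quantile_le_iff[OF u, of w] that by (simp add: F_def)
      moreover have "X (F w) \<le> X u" if "0 < F w"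
        using mono_onD[OF \<mu>.mono_on_quantile, of "F w" u] u \<open>F w < u\<close> that by auto
      ultimately show ?thesis using gL[of "X u - w"] u by (auto simp: G_def intro!: mg)
    qed
  qed blast
  have \<pi>': "prob_space \<pi>" "sets \<pi> = sets (borel \<Otimes>\<^sub>M borel)" "distr \<pi> borel fst = \<mu>" "distr \<pi> borel snd = \<nu>"
    using \<pi> by (auto simp: couplings_def)
  interpret \<pi>: prob_space \<pi> by fact
  have fst_m [measurable]: "fst \<in> borel_measurable \<pi>" and snd_m [measurable]: "snd \<in> borel_measurable \<pi>"
    unfolding measurable_cong_sets[OF \<pi>'(2) refl] by measurable
  have fL: "L-lipschitz_on UNIV f" using sg gL by (rule subgradient_lipschitz_on)
  have [measurable]: "f \<in> borel_measurable borel" "P \<in> borel_measurable borel" "\<phi> \<in> borel_measurable borel"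
    by (rule lipschitz_on_borel_measurable[OF fL] lipschitz_on_borel_measurable[OF D(1)]
        lipschitz_on_borel_measurable[OF D(2)])+
  have i1: "integrable \<pi> fst" "integrable \<pi> snd"
    using integrable_distr[of fst \<pi> borel "\<lambda>x. x"] integrable_distr[of snd \<pi> borel "\<lambda>x. x"]
    by (simp_all only: \<pi>' integrable_id fst_m snd_m)
  have i2: "integrable \<pi> (\<lambda>z. f (fst z - snd z))" "integrable \<pi> (\<lambda>z. \<phi> (fst z))" "integrable \<pi> (\<lambda>z. P (snd z))"
    by (rule \<pi>.integrable_lipschitz[OF fL Bochner_Integration.integrable_diff[OF i1]],
        rule \<pi>.integrable_lipschitz[OF D(1) i1(1)], rule \<pi>.integrable_lipschitz[OF D(2) i1(2)])
  have i3: "integrable U01 (\<lambda>u. f (X u - Y u))"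
    by (rule U.integrable_lipschitz[OF fL Bochner_Integration.integrable_diff[OF integrable_quantile]])
  have "(\<integral>u. f (X u - Y u) \<partial>U01) = (\<integral>z. \<phi> (fst z) \<partial>\<pi>) - (\<integral>z. P (snd z) \<partial>\<pi>)"
    using integral_distr[of fst \<pi> borel \<phi>] integral_distr[of snd \<pi> borel P] by (simp add: D(4)[symmetric] \<pi>')
  also have "\<dots> = (\<integral>z. \<phi> (fst z) - P (snd z) \<partial>\<pi>)" using i2 by simp
  also have "\<dots> \<le> (\<integral>z. f (fst z - snd z) \<partial>\<pi>)"
    by (rule integral_mono) (use i2 D(3) in \<open>auto simp: algebra_simps\<close>)
  finally show ?thesis
    using i2 i3 pos by (simp add: nn_integral_eq_integral ennreal_leI)
qed

text \<open>For each \<open>u\<close> the cutoffs reach the value \<open>f (X u - Y u)\<close> from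
  some \<open>n\<close> on, so Fatou's lemma passes the bound \<open>B\<close> to the limit.\<close>

lemma monotone_cost_le_by_cutoff:
  assumes sg: "subgradient f g" and f: "\<And>t. 0 \<le> f t"
    and fm: "f \<in> borel_measurable borel"
    and le: "\<And>n::nat. monotone_cost (linear_cutoff f g (real (Suc n))) \<le> B"
  shows "monotone_cost f \<le> B"
proof -
  let ?f = "\<lambda>n u. ennreal (linear_cutoff f g (real (Suc n)) (X u - Y u))"
  have gm: "g \<in> borel_measurable borel" by (intro borel_measurable_mono subgradient_mono[OF sg])
  have [measurable]: "linear_cutoff f g N \<in> borel_measurable borel" for N
    unfolding linear_cutoff_def clamp_real_def using fm gm by measurable
  have lim: "liminf (\<lambda>n. ?f n u) = ennreal (f (X u - Y u))" for u
  proof (rule lim_imp_Liminf)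
    obtain m :: nat where m: "\<bar>X u - Y u\<bar> \<le> real m" using real_arch_simple by blast
    have "\<forall>\<^sub>F n in sequentially. ?f n u = ennreal (f (X u - Y u))"
      using eventually_ge_at_top[of m] by eventually_elim (use m in \<open>auto simp: linear_cutoff_eq\<close>)
    then show "(\<lambda>n. ?f n u) \<longlonglongrightarrow> ennreal (f (X u - Y u))" by (rule tendsto_eventually)
  qed simp
  have "monotone_cost f = (\<integral>\<^sup>+u. liminf (\<lambda>n. ?f n u) \<partial>U01)" unfolding lim ..
  also have "\<dots> \<le> liminf (\<lambda>n. integral\<^sup>N U01 (?f n))" by (rule nn_integral_liminf) measurable
  also have "\<dots> \<le> liminf (\<lambda>n::nat. B)" by (intro Liminf_mono always_eventually allI le)
  also have "\<dots> = B" by (simp add: Liminf_const)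
  finally show ?thesis .
qed

lemma transport_cost_eq_monotone_cost:
  assumes sg: "subgradient \<theta> g" and \<theta>: "\<And>t. 0 \<le> \<theta> t" "\<theta> 0 = 0" "\<And>t. \<theta> (- t) = \<theta> t"
    and \<theta>m: "\<theta> \<in> borel_measurable borel"
  shows "transport_cost \<theta> \<mu> \<nu> = monotone_cost \<theta>"
proof (rule antisym)
  have a: "\<theta> \<bar>t\<bar> = \<theta> t" for t using \<theta>(3)[of t] by (auto simp: abs_if)
  have "transport_cost \<theta> \<mu> \<nu> \<le> (\<integral>\<^sup>+z. ennreal (\<theta> \<bar>fst z - snd z\<bar>) \<partial>distr U01 (borel \<Otimes>\<^sub>M borel) (\<lambda>u. (X u, Y u)))"
    unfolding transport_cost_def by (rule INF_lower[OF monotone_coupling])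
  also have "\<dots> = monotone_cost \<theta>"
    by (subst nn_integral_distr) (use \<theta>m in \<open>simp_all add: a\<close>)
  finally show "transport_cost \<theta> \<mu> \<nu> \<le> monotone_cost \<theta>" .
  show "monotone_cost \<theta> \<le> transport_cost \<theta> \<mu> \<nu>"
    unfolding transport_cost_def
  proof (rule INF_greatest)
    fix \<pi> assume \<pi>: "\<pi> \<in> couplings \<mu> \<nu>"
    show "monotone_cost \<theta> \<le> (\<integral>\<^sup>+z. ennreal (\<theta> \<bar>fst z - snd z\<bar>) \<partial>\<pi>)"
    proof (rule monotone_cost_le_by_cutoff[OF sg \<theta>(1) \<theta>m])
      fix n :: nat
      \<comment> \<open>The successor ensures a positive cutoff level, as
        \<open>linear_cutoff_nonneg\<close> demands.\<close>
      let ?N = "real (Suc n)"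
      have "monotone_cost (linear_cutoff \<theta> g ?N) \<le> (\<integral>\<^sup>+z. ennreal (linear_cutoff \<theta> g ?N (fst z - snd z)) \<partial>\<pi>)"
        by (rule coupling_lower_bound_lipschitz[OF subgradient_linear_cutoff[OF sg]
              linear_cutoff_slope_bounded[OF sg] linear_cutoff_nonneg[OF sg] \<pi>]) (use \<theta> in auto)
      also have "\<dots> \<le> (\<integral>\<^sup>+z. ennreal (\<theta> \<bar>fst z - snd z\<bar>) \<partial>\<pi>)"
        unfolding a by (intro nn_integral_mono ennreal_leI linear_cutoff_le sg)
      finally show "monotone_cost (linear_cutoff \<theta> g ?N) \<le> (\<integral>\<^sup>+z. ennreal (\<theta> \<bar>fst z - snd z\<bar>) \<partial>\<pi>)" .
    qed
  qed
qed

end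

subsection \<open>The weak transport cost\<close>

lemma nn_integral_U01: "h \<in> borel_measurable borel \<Longrightarrow> (\<integral>\<^sup>+u. h u \<partial>U01) = (\<integral>\<^sup>+u. h u * indicator {0<..<1} u \<partial>lborel)"
  by (subst nn_integral_restrict_space) auto

lemma emeasure_U01_lessThan: "0 \<le> t \<Longrightarrow> t \<le> 1 \<Longrightarrow> emeasure U01 {0<..<t} = ennreal t"
  by (subst emeasure_restrict_space) auto

lemma measure_U01_lessThan: "0 \<le> t \<Longrightarrow> t \<le> 1 \<Longrightarrow> measure U01 {0<..<t} = t"
  by (simp add: measure_def emeasure_U01_lessThan)

lemma set_U01_lessThan: "t \<le> 1 \<Longrightarrow> {0<..<t} \<in> sets U01"
  by (auto simp: sets_restrict_space_iff)

text \<open>Two-point laws are realised by comparing a uniform variable \<open>v\<close> with the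
  weight \<open>t\<close>; this evaluates their means.\<close>

lemma integral_U01_step:
  fixes a b t :: real
  assumes t: "0 \<le> t" "t \<le> 1"
  shows "(\<integral>v. (if v < t then a else b) \<partial>U01) = t * a + (1 - t) * b"
proof -
  interpret prob_space U01 by (rule prob_space_U01)
  have "(\<integral>v. (if v < t then a else b) \<partial>U01) = (\<integral>v. b + (a - b) * indicator {0<..<t} v \<partial>U01)"
    by (rule Bochner_Integration.integral_cong) (auto simp: space_restrict_space indicator_def)
  also have "\<dots> = b + (a - b) * t"
    using t set_U01_lessThan[of t] prob_space
    by (subst Bochner_Integration.integral_add) (auto simp: measure_U01_lessThan emeasure_U01_lessThan integrable_real_indicator)
  finally show ?thesis by (simp add: algebra_simps)
qed

context two_laws
begin

text \<open>The cost sees only the barycentre of \<open>p x\<close>, so \<open>P\<close> at that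
  point must be bounded by its mean under \<open>p x\<close>. A monotone slope \<open>G\<close>
  makes \<open>P\<close> convex and Jensen's inequality available.\<close>

lemma kernel_lower_bound_lipschitz:
  assumes sg: "subgradient f g" and gL: "\<And>t. \<bar>g t\<bar> \<le> L" and pos: "\<And>t. 0 \<le> f t"
    and mono: "mono_on {0<..<1} (\<lambda>u. X u - Y u)"
    and p: "p \<in> coupling_kernels \<mu> \<nu>"
  shows "monotone_cost f \<le> (\<integral>\<^sup>+x. ennreal (f (x - (\<integral>y. y \<partial>p x))) \<partial>\<mu>)"
proof -
  \<comment> \<open>The set grows with \<open>w\<close>, so its supremum \<open>G\<close> is
    monotone by construction. The element \<open>- L\<close> keeps it nonempty when no
    \<open>Y u\<close> is at most \<open>w\<close>.\<close>
  define S where "S w = insert (- L) {g (X u - Y u) | u. 0 < u \<and> u < 1 \<and> Y u \<le> w}" for w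
  define G where "G w = Sup (S w)" for w
  have L: "0 \<le> L" using gL[of 0] by simp
  have "s \<le> L \<and> - L \<le> s" if "s \<in> S w" for s w
    using that gL L unfolding S_def by (auto simp: abs_le_iff minus_le_iff)
  then have bdd: "bdd_above (S w)" and SL: "\<And>s. s \<in> S w \<Longrightarrow> s \<le> L" for w by (auto simp: bdd_above_def)
  have ne: "S w \<noteq> {}" for w by (simp add: S_def)
  have GL: "\<bar>G w\<bar> \<le> L" for w
    using cSup_upper[OF _ bdd, of "- L" w] cSup_least[OF ne SL, of w] by (auto simp: G_def S_def abs_le_iff)
  have Gmono: "mono G"
    unfolding G_def by (intro monoI cSup_subset_mono ne bdd) (auto simp: S_def)
  have Gm: "G \<in> borel_measurable borel" using Gmono by (rule borel_measurable_mono)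
  have mg: "g a \<le> g b" if "a \<le> b" for a b using subgradient_mono[OF sg] that by (rule monoD)
  obtain \<phi> P where P: "\<And>a b. a \<le> b \<Longrightarrow> (G has_integral (P b - P a)) {a..b}"
    and D: "L-lipschitz_on UNIV \<phi>" "L-lipschitz_on UNIV P" "\<And>x y. \<phi> x \<le> f (x - y) + P y"
    "integral\<^sup>L \<mu> \<phi> - integral\<^sup>L \<nu> P = (\<integral>u. f (X u - Y u) \<partial>U01)"
  proof (rule dual_potentials[OF sg gL Gm GL])
    fix u w :: real assume u: "0 < u" "u < 1"
    show "g (X u - w) \<le> G w" if "Y u \<le> w"
    proof -
      have "g (X u - w) \<le> g (X u - Y u)" using that by (intro mg) simp
      also have "\<dots> \<le> G w"
        unfolding G_def by (rule cSup_upper[OF _ bdd]) (use u that in \<open>auto simp: S_def\<close>)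
      finally show ?thesis .
    qed
    show "G w \<le> g (X u - w)" if w: "w < Y u"
      unfolding G_def
    proof (rule cSup_least[OF ne])
      fix s assume "s \<in> S w"
      then consider "s = - L" | v where "s = g (X v - Y v)" "0 < v" "v < 1" "Y v \<le> w"
        by (auto simp: S_def)
      then show "s \<le> g (X u - w)"
      proof cases
        case 1
        then show ?thesis using gL[of "X u - w"] by auto
      next
        case 2
        \<comment> \<open>Monotonicity of \<open>X - Y\<close> enters here:
          \<open>Y v \<le> w < Y u\<close> forces \<open>v < u\<close>, so the slope at level
          \<open>v\<close> is at most \<open>g (X u - Y u)\<close>, hence at most
          \<open>g (X u - w)\<close>.\<close>
        have "\<not> u \<le> v"
          using mono_onD[OF \<nu>.mono_on_quantile, of u v] u 2 w by auto
        then have "X v - Y v \<le> X u - Y u" using mono_onD[OF mono, of v u] u 2 by auto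
        then show ?thesis using w by (auto simp: 2 intro!: mg)
      qed
    qed
  qed blast
  have P_sub: "subgradient P G" using P Gmono by (rule antiderivative_convex_tangent)
  have pm: "p \<in> borel \<rightarrow>\<^sub>M prob_algebra borel" and bind: "\<mu> \<bind> p = \<nu>"
    using p by (auto simp: coupling_kernels_def)
  have ps: "p \<in> \<mu> \<rightarrow>\<^sub>M subprob_algebra borel"
    using measurable_prob_algebraD[OF pm] by (subst measurable_cong_sets[OF \<mu>.events_eq_borel refl])
  have pp: "prob_space (p x)" for x
    using measurable_space[OF pm, of x] by (simp add: space_prob_algebra)
  have fL: "L-lipschitz_on UNIV f" using sg gL by (rule subgradient_lipschitz_on)
  have Pm: "P \<in> borel_measurable borel" by (rule lipschitz_on_borel_measurable[OF D(2)])
  let ?m = "\<lambda>x. \<integral>y. y \<partial>p x"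
  have iP: "integrable \<nu> P" by (rule \<nu>.integrable_lipschitz[OF D(2) integrable_id(2)])
  have i\<phi>: "integrable \<mu> \<phi>" by (rule \<mu>.integrable_lipschitz[OF D(1) integrable_id(1)])
  note M = integral_bind_borel[OF ps, unfolded bind, OF integrable_id(2) measurable_ident[unfolded id_def]]
  note Q = integral_bind_borel[OF ps, unfolded bind, OF iP Pm]
  have fi: "integrable \<mu> (\<lambda>x. f (x - ?m x))"
    by (rule \<mu>.integrable_lipschitz[OF fL Bochner_Integration.integrable_diff[OF integrable_id(1) M(2)]])
  have fU: "integrable U01 (\<lambda>u. f (X u - Y u))"
    by (rule U.integrable_lipschitz[OF fL Bochner_Integration.integrable_diff[OF integrable_quantile]])
  have jensen: "AE x in \<mu>. P (?m x) \<le> (\<integral>y. P y \<partial>p x)"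
    using M(1) Q(1)
  proof eventually_elim
    case (elim x)
    interpret px: prob_space "p x" by (rule pp)
    \<comment> \<open>The tangent to \<open>P\<close> at the barycentre lies below \<open>P\<close>
      and integrates to \<open>P (?m x)\<close>.\<close>
    have "(\<integral>y. P (?m x) + G (?m x) * (y - ?m x) \<partial>p x) \<le> (\<integral>y. P y \<partial>p x)"
      by (rule integral_mono) (use elim subgradientD[OF P_sub] in auto)
    moreover have "(\<integral>y. P (?m x) + G (?m x) * (y - ?m x) \<partial>p x) = P (?m x)"
      using elim by (simp add: px.prob_space)
    ultimately show ?case by simp
  qed
  have "(\<integral>u. f (X u - Y u) \<partial>U01) = (\<integral>x. \<phi> x - (\<integral>y. P y \<partial>p x) \<partial>\<mu>)"
    using i\<phi> Q(2) by (simp add: D(4)[symmetric] Q(3))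
  also have "\<dots> \<le> (\<integral>x. f (x - ?m x) \<partial>\<mu>)"
  proof (rule integral_mono_AE)
    show "AE x in \<mu>. \<phi> x - (\<integral>y. P y \<partial>p x) \<le> f (x - ?m x)"
      using jensen by eventually_elim (use D(3) in \<open>smt (verit)\<close>)
  qed (use i\<phi> Q(2) fi in auto)
  finally show ?thesis
    using fi fU pos by (simp add: nn_integral_eq_integral ennreal_leI)
qed

lemma monotone_cost_le_weak_transport_cost:
  assumes sg: "subgradient \<theta> g" and \<theta>: "\<And>t. 0 \<le> \<theta> t" "\<theta> 0 = 0" "\<And>t. \<theta> (- t) = \<theta> t"
    and \<theta>m: "\<theta> \<in> borel_measurable borel"
    and mono: "mono_on {0<..<1} (\<lambda>u. X u - Y u)"
  shows "monotone_cost \<theta> \<le> weak_transport_cost \<theta> \<nu> \<mu>"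
  unfolding weak_transport_cost_def weak_cost_of_def
proof (rule INF_greatest)
  have a: "\<theta> \<bar>t\<bar> = \<theta> t" for t using \<theta>(3)[of t] by (auto simp: abs_if)
  fix p assume p: "p \<in> coupling_kernels \<mu> \<nu>"
  let ?c = "\<integral>\<^sup>+x. ennreal (\<theta> \<bar>x - (\<integral>y. y \<partial>p x)\<bar>) \<partial>\<mu>"
  show "monotone_cost \<theta> \<le> ?c"
  proof (rule monotone_cost_le_by_cutoff[OF sg \<theta>(1) \<theta>m])
    fix n :: nat
    let ?N = "real (Suc n)"
    have "monotone_cost (linear_cutoff \<theta> g ?N) \<le> (\<integral>\<^sup>+x. ennreal (linear_cutoff \<theta> g ?N (x - (\<integral>y. y \<partial>p x))) \<partial>\<mu>)"
      by (rule kernel_lower_bound_lipschitz[OF subgradient_linear_cutoff[OF sg]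
            linear_cutoff_slope_bounded[OF sg] linear_cutoff_nonneg[OF sg] mono p]) (use \<theta> in auto)
    also have "\<dots> \<le> ?c"
      unfolding a by (intro nn_integral_mono ennreal_leI linear_cutoff_le sg)
    finally show "monotone_cost (linear_cutoff \<theta> g ?N) \<le> ?c" .
  qed
qed

text \<open>A kernel \<open>K\<close> indexed by levels becomes one on points by composition with
  the distribution function of \<open>\<mu>\<close>. Without atoms this function recovers
  \<open>u\<close> from \<open>X u\<close>, so no level is lost.\<close>

lemma weak_transport_cost_le_kernel:
  assumes even: "\<And>t. \<theta> (- t) = \<theta> t" and \<theta>m: "\<theta> \<in> borel_measurable borel"
    and atom: "\<And>x. measure \<mu> {x} = 0"
    and K: "K \<in> borel \<rightarrow>\<^sub>M prob_algebra borel" and bind: "U01 \<bind> K = \<nu>"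
  shows "weak_transport_cost \<theta> \<nu> \<mu> \<le> (\<integral>\<^sup>+u. ennreal (\<theta> (X u - (\<integral>y. y \<partial>K u))) \<partial>U01)"
proof -
  have a: "\<theta> \<bar>t\<bar> = \<theta> t" for t using even[of t] by (auto simp: abs_if)
  define p where "p x = K (Defs.cdf \<mu> x)" for x
  have pX: "p (X u) = K u" if "u \<in> space U01" for u
    using \<mu>.cdf_quantile[OF _ _ atom] that by (simp add: p_def space_restrict_space)
  have pm: "p \<in> borel \<rightarrow>\<^sub>M prob_algebra borel"
    unfolding p_def by (rule measurable_compose[OF _ K]) (intro borel_measurable_mono \<mu>.mono_cdf)
  have ps: "p \<in> borel \<rightarrow>\<^sub>M subprob_algebra borel" using pm by (rule measurable_prob_algebraD)
  have "\<mu> \<bind> p = distr U01 borel X \<bind> p" by (simp add: \<mu>.distr_quantile)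
  also have "\<dots> = U01 \<bind> (\<lambda>u. p (X u))"
    by (rule bind_distr[OF \<mu>.quantile_measurable ps U.not_empty])
  also have "\<dots> = U01 \<bind> K" by (rule bind_cong) (simp_all add: pX)
  finally have "p \<in> coupling_kernels \<mu> \<nu>" using pm bind by (simp add: coupling_kernels_def)
  then have "weak_transport_cost \<theta> \<nu> \<mu> \<le> weak_cost_of \<theta> \<mu> p"
    unfolding weak_transport_cost_def by (rule INF_lower)
  also have "\<dots> = (\<integral>\<^sup>+x. ennreal (\<theta> (x - (\<integral>y. y \<partial>p x))) \<partial>\<mu>)"
    by (simp add: weak_cost_of_def a)
  also have "\<dots> = (\<integral>\<^sup>+u. ennreal (\<theta> (X u - (\<integral>y. y \<partial>p (X u)))) \<partial>U01)"
  proof (rule nn_integral_mu)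
    have "(\<lambda>x. \<integral>y. y \<partial>p x) \<in> borel_measurable borel"
      by (rule measurable_compose[OF ps integral_measurable_subprob_algebra]) simp
    with \<theta>m show "(\<lambda>x. ennreal (\<theta> (x - (\<integral>y. y \<partial>p x)))) \<in> borel_measurable borel" by measurable
  qed
  also have "\<dots> = (\<integral>\<^sup>+u. ennreal (\<theta> (X u - (\<integral>y. y \<partial>K u))) \<partial>U01)"
    by (rule nn_integral_cong) (simp add: pX)
  finally show ?thesis .
qed

text \<open>The kernel sends \<open>X u\<close> to \<open>Y (\<sigma> u)\<close> with probability \<open>t u\<close> and to \<open>Y u\<close> otherwise.\<close>

lemma weak_transport_cost_le_swap:
  assumes even: "\<And>t. \<theta> (- t) = \<theta> t" and \<theta>m: "\<theta> \<in> borel_measurable borel"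
    and atom: "\<And>x. measure \<mu> {x} = 0"
    and \<sigma>: "\<sigma> \<in> borel_measurable borel" "\<And>u. 0 < u \<Longrightarrow> u < 1 \<Longrightarrow> 0 < \<sigma> u \<and> \<sigma> u < 1"
    and pres: "\<And>h. h \<in> borel_measurable borel \<Longrightarrow> (\<integral>\<^sup>+u. h (\<sigma> u) \<partial>U01) = (\<integral>\<^sup>+u. h u \<partial>U01)"
    and Y': "Y' \<in> borel_measurable borel" "\<And>u. 0 < u \<Longrightarrow> u < 1 \<Longrightarrow> Y' u = Y u"
    and t: "t \<in> borel_measurable borel" "\<And>u. 0 < u \<Longrightarrow> u < 1 \<Longrightarrow> 0 \<le> t u \<and> t u \<le> 1 \<and> t (\<sigma> u) = t u"
  shows "weak_transport_cost \<theta> \<nu> \<mu> \<le> (\<integral>\<^sup>+u. ennreal (\<theta> (X u - (t u * Y (\<sigma> u) + (1 - t u) * Y u))) \<partial>U01)"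
proof -
  note [measurable] = \<sigma>(1) Y'(1) t(1)
  \<comment> \<open>The uniform variable \<open>v\<close> makes the random choice; \<open>Y'\<close>
    replaces \<open>Y\<close> so that \<open>K\<close> is measurable on the whole line.\<close>
  define K where "K u = distr U01 borel (\<lambda>v. if v < t u then Y' (\<sigma> u) else Y' u)" for u
  have U: "U01 \<in> space (prob_algebra U01)" by (simp add: space_prob_algebra prob_space_U01)
  have [measurable]: "(\<lambda>v. v) \<in> borel_measurable U01" by (rule measurable_restrict_space1) simp
  have K: "K \<in> borel \<rightarrow>\<^sub>M prob_algebra borel"
    unfolding K_def by (rule measurable_distr_prob_space2[OF measurable_const[OF U]]) measurable
  have Ks: "K \<in> U01 \<rightarrow>\<^sub>M subprob_algebra borel"
    by (intro measurable_restrict_space1 measurable_prob_algebraD) (simp add: K)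
  have mean: "(\<integral>y. y \<partial>K u) = t u * Y (\<sigma> u) + (1 - t u) * Y u" if "0 < u" "u < 1" for u
  proof -
    have "(\<integral>y. y \<partial>K u) = (\<integral>v. (if v < t u then Y' (\<sigma> u) else Y' u) \<partial>U01)"
      unfolding K_def by (rule integral_distr) measurable
    then show ?thesis using that t(2)[OF that] \<sigma>(2)[OF that] by (simp add: integral_U01_step Y')
  qed
  have "U01 \<bind> K = \<nu>"
  proof (rule measure_eqI)
    show s: "sets (U01 \<bind> K) = sets \<nu>"
      using sets_bind_measurable[OF Ks U.not_empty] by simp
    fix A assume "A \<in> sets (U01 \<bind> K)"
    then have A [measurable]: "A \<in> sets borel" using s by simp
    let ?i = "indicator A :: real \<Rightarrow> real"
    have KA: "emeasure (K u) A = ennreal (t u * ?i (Y' (\<sigma> u))) + ennreal ((1 - t u) * ?i (Y' u))" if "0 < u" "u < 1" for u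
    proof -
      interpret K: prob_space "K u" unfolding K_def by (rule U.prob_space_distr) measurable
      have "measure (K u) A = (\<integral>y. ?i y \<partial>K u)"
        by (simp add: K_def)
      also have "\<dots> = (\<integral>v. ?i (if v < t u then Y' (\<sigma> u) else Y' u) \<partial>U01)"
        unfolding K_def by (rule integral_distr) measurable
      also have "\<dots> = (\<integral>v. (if v < t u then ?i (Y' (\<sigma> u)) else ?i (Y' u)) \<partial>U01)"
        by (rule Bochner_Integration.integral_cong) auto
      also have "\<dots> = t u * ?i (Y' (\<sigma> u)) + (1 - t u) * ?i (Y' u)"
        using t(2)[OF that] by (simp add: integral_U01_step)
      finally show ?thesis
        using t(2)[OF that] by (simp add: K.emeasure_eq_measure ennreal_plus[symmetric] del: ennreal_plus)
    qed
    have "emeasure (U01 \<bind> K) A = (\<integral>\<^sup>+u. emeasure (K u) A \<partial>U01)"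
      by (rule emeasure_bind[OF U.not_empty Ks A])
    \<comment> \<open>Writing \<open>t u\<close> as \<open>t (\<sigma> u)\<close> makes the first
      summand a function of \<open>\<sigma> u\<close> alone, so \<open>pres\<close> moves it back to
      \<open>u\<close> and the weights add up to \<open>1\<close>.\<close>
    also have "\<dots> = (\<integral>\<^sup>+u. ennreal (t (\<sigma> u) * ?i (Y' (\<sigma> u))) + ennreal ((1 - t u) * ?i (Y' u)) \<partial>U01)"
      by (rule nn_integral_cong) (simp add: space_restrict_space KA t(2))
    also have "\<dots> = (\<integral>\<^sup>+u. ennreal (t (\<sigma> u) * ?i (Y' (\<sigma> u))) \<partial>U01) + (\<integral>\<^sup>+u. ennreal ((1 - t u) * ?i (Y' u)) \<partial>U01)"
      by (rule nn_integral_add) measurable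
    also have "(\<integral>\<^sup>+u. ennreal (t (\<sigma> u) * ?i (Y' (\<sigma> u))) \<partial>U01) = (\<integral>\<^sup>+u. ennreal (t u * ?i (Y' u)) \<partial>U01)"
      by (rule pres) measurable
    also have "\<dots> + (\<integral>\<^sup>+u. ennreal ((1 - t u) * ?i (Y' u)) \<partial>U01)
      = (\<integral>\<^sup>+u. ennreal (t u * ?i (Y' u)) + ennreal ((1 - t u) * ?i (Y' u)) \<partial>U01)"
      by (rule nn_integral_add[symmetric]) measurable
    also have "\<dots> = (\<integral>\<^sup>+u. indicator A (Y u) \<partial>U01)"
    proof (rule nn_integral_cong)
      fix u assume "u \<in> space U01"
      then have "0 \<le> t u" "t u \<le> 1" "Y' u = Y u" using t(2) Y'(2) by (auto simp: space_restrict_space)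
      then show "ennreal (t u * ?i (Y' u)) + ennreal ((1 - t u) * ?i (Y' u)) = indicator A (Y u)"
        by (auto simp: indicator_def ennreal_plus[symmetric] simp del: ennreal_plus)
    qed
    also have "\<dots> = (\<integral>\<^sup>+y. indicator A y \<partial>distr U01 borel Y)"
      by (rule nn_integral_distr[OF \<nu>.quantile_measurable, symmetric]) (simp add: A)
    also have "\<dots> = emeasure \<nu> A" by (simp add: \<nu>.distr_quantile)
    finally show "emeasure (U01 \<bind> K) A = emeasure \<nu> A" .
  qed
  from weak_transport_cost_le_kernel[OF even \<theta>m atom K this]
  have "weak_transport_cost \<theta> \<nu> \<mu> \<le> (\<integral>\<^sup>+u. ennreal (\<theta> (X u - (\<integral>y. y \<partial>K u))) \<partial>U01)" .
  also have "\<dots> = (\<integral>\<^sup>+u. ennreal (\<theta> (X u - (t u * Y (\<sigma> u) + (1 - t u) * Y u))) \<partial>U01)"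
    by (rule nn_integral_cong) (simp add: space_restrict_space mean)
  finally show ?thesis .
qed

end

subsection \<open>Exchanging mass between two intervals\<close>

text \<open>The intervals are closed at their right ends \<open>a\<close> and \<open>b\<close>
  because quantile functions are left-continuous: a strict drop from \<open>a\<close> to
  \<open>b\<close> persists slightly to the left.\<close>

definition interval_swap :: "real \<Rightarrow> real \<Rightarrow> real \<Rightarrow> real \<Rightarrow> real" where
  "interval_swap a b \<delta> u = (if a - \<delta> < u \<and> u \<le> a then u + (b - a)
     else if b - \<delta> < u \<and> u \<le> b then u - (b - a) else u)"

lemma interval_swap_measurable: "interval_swap a b \<delta> \<in> borel_measurable borel"
  unfolding interval_swap_def by measurable

lemma nn_integral_interval_swap:
  assumes \<delta>: "0 \<le> \<delta>" "\<delta> \<le> b - a" "\<delta> \<le> a" "b < 1"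
    and [measurable]: "h \<in> borel_measurable borel"
  shows "(\<integral>\<^sup>+u. h (interval_swap a b \<delta> u) \<partial>U01) = (\<integral>\<^sup>+u. h u \<partial>U01)"
proof -
  note interval_swap_measurable [measurable]
  let ?I = "{a - \<delta><..a}" and ?J = "{b - \<delta><..b}" and ?c = "b - a"
  let ?R = "{0<..<1} - ?I - ?J"
  have shift: "(\<integral>\<^sup>+u. f u \<partial>lborel) = (\<integral>\<^sup>+u. f (c + u) \<partial>lborel)"
    if "f \<in> borel_measurable borel" for f :: "real \<Rightarrow> ennreal" and c
    using nn_integral_real_affine[of f 1 c] that by simp
  have "(\<integral>\<^sup>+u. h (interval_swap a b \<delta> u) \<partial>U01) = (\<integral>\<^sup>+u. h (interval_swap a b \<delta> u) * indicator {0<..<1} u \<partial>lborel)"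
    by (rule nn_integral_U01) measurable
  \<comment> \<open>A point of \<open>?I\<close> is sent into \<open>?J\<close>, which
    \<open>indicator ?J (?c + u)\<close> records, and conversely. Each term is then a translate, and
    Lebesgue measure is translation invariant.\<close>
  also have "\<dots> = (\<integral>\<^sup>+u. (h (?c + u) * indicator ?J (?c + u) + h (- ?c + u) * indicator ?I (- ?c + u)) + h u * indicator ?R u \<partial>lborel)"
    by (rule nn_integral_cong) (use \<delta> in \<open>auto simp: interval_swap_def indicator_def algebra_simps\<close>)
  also have "\<dots> = ((\<integral>\<^sup>+u. h (?c + u) * indicator ?J (?c + u) \<partial>lborel) + (\<integral>\<^sup>+u. h (- ?c + u) * indicator ?I (- ?c + u) \<partial>lborel))
      + (\<integral>\<^sup>+u. h u * indicator ?R u \<partial>lborel)"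
    by (subst nn_integral_add, measurable, subst nn_integral_add, measurable)
  also have "(\<integral>\<^sup>+u. h (?c + u) * indicator ?J (?c + u) \<partial>lborel) = (\<integral>\<^sup>+u. h u * indicator ?J u \<partial>lborel)"
    by (rule shift[symmetric]) measurable
  also have "(\<integral>\<^sup>+u. h (- ?c + u) * indicator ?I (- ?c + u) \<partial>lborel) = (\<integral>\<^sup>+u. h u * indicator ?I u \<partial>lborel)"
    by (rule shift[symmetric]) measurable
  also have "(\<integral>\<^sup>+u. h u * indicator ?J u \<partial>lborel) + (\<integral>\<^sup>+u. h u * indicator ?I u \<partial>lborel)
      + (\<integral>\<^sup>+u. h u * indicator ?R u \<partial>lborel)
    = (\<integral>\<^sup>+u. (h u * indicator ?J u + h u * indicator ?I u) + h u * indicator ?R u \<partial>lborel)"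
    by (subst nn_integral_add, measurable, subst nn_integral_add, measurable)
  also have "\<dots> = (\<integral>\<^sup>+u. h u * indicator {0<..<1} u \<partial>lborel)"
    by (rule nn_integral_cong) (use \<delta> in \<open>auto simp: indicator_def\<close>)
  also have "\<dots> = (\<integral>\<^sup>+u. h u \<partial>U01)" by (rule nn_integral_U01[symmetric]) measurable
  finally show ?thesis .
qed

text \<open>This is left continuity at \<open>u\<close>, with an explicit left neighbourhood
  beginning at the level \<open>cdf M x\<close>.\<close>

lemma (in real_distribution) quantile_left_lower:
  assumes "0 < u" "u < 1" "x < quantile M u"
  shows "0 \<le> Defs.cdf M x" "Defs.cdf M x < u"
    "\<And>v. Defs.cdf M x < v \<Longrightarrow> v < 1 \<Longrightarrow> x < quantile M v"
proof -
  show 0: "0 \<le> Defs.cdf M x" by (simp add: Defs.cdf_def)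
  show "Defs.cdf M x < u" using quantile_le_iff[of u x] assms by auto
  show "x < quantile M v" if "Defs.cdf M x < v" "v < 1" for v
    using quantile_le_iff[of v x] that 0 by auto
qed

lemma strictly_convex_midpoint:
  assumes "strictly_convex \<theta>" "x \<noteq> y"
  shows "\<theta> ((x + y) / 2) < (\<theta> x + \<theta> y) / 2"
proof -
  have "\<theta> (1/2 * x + (1 - 1/2) * y) < 1/2 * \<theta> x + (1 - 1/2) * \<theta> y"
    using assms unfolding strictly_convex_def by (metis half_gt_zero_iff zero_less_one divide_less_eq_1_pos one_less_numeral_iff semiring_norm(76) zero_less_numeral)
  moreover have "1/2 * x + (1 - 1/2) * y = (x + y) / 2" by (simp add: field_simps)
  ultimately show ?thesis by (simp add: field_simps)
qed

context two_laws
begin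

text \<open>Moving left, \<open>X\<close> loses less than \<open>e\<close> from \<open>X a\<close>
  and \<open>Y\<close> less than \<open>e\<close> from \<open>Y b\<close>, by left continuity;
  \<open>Y u \<le> Y a\<close> and \<open>X ?v \<le> X b\<close> hold by monotonicity and work in
  favour of the drop.\<close>

lemma drop_on_intervals:
  assumes ab: "0 < a" "a \<le> b" "b < 1" and drop: "X b - Y b < X a - Y a"
  obtains \<delta> where "0 < \<delta>" "\<delta> \<le> b - a" "\<delta> \<le> a"
    "\<And>u. a - \<delta> < u \<Longrightarrow> u \<le> a \<Longrightarrow> X (u + (b - a)) - Y (u + (b - a)) < X u - Y u"
proof -
  \<comment> \<open>One third of the drop: two errors below \<open>e\<close> cannot use up
    \<open>3 * e\<close>.\<close>
  define e where "e = ((X a - Y a) - (X b - Y b)) / 3"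
  have e3: "3 * e = (X a - Y a) - (X b - Y b)" by (simp add: e_def)
  have e: "0 < e" using drop by (simp add: e_def)
  have b1: "0 < b" "a < 1" using ab by auto
  define l where "l = Defs.cdf \<mu> (X a - e)"
  define m where "m = Defs.cdf \<nu> (Y b - e)"
  note L = \<mu>.quantile_left_lower[of a "X a - e", folded l_def]
  note M = \<nu>.quantile_left_lower[of b "Y b - e", folded m_def]
  have "a \<noteq> b" using drop by auto
  define \<delta> where "\<delta> = min (min (a - l) (b - m)) (b - a)"
  show ?thesis
  proof
    show "0 < \<delta>" using L(2) M(2) ab b1 e \<open>a \<noteq> b\<close> by (simp add: \<delta>_def)
    show "\<delta> \<le> b - a" by (simp add: \<delta>_def)
    show "\<delta> \<le> a" using L(1) ab b1 e by (simp add: \<delta>_def)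
    fix u assume u: "a - \<delta> < u" "u \<le> a"
    let ?v = "u + (b - a)"
    have "l < u" "m < ?v" using u by (auto simp: \<delta>_def)
    then have "X a - e < X u" "Y b - e < Y ?v"
      using L(3)[of u] M(3)[of ?v] ab b1 e u by auto
    moreover have "0 < u" using L(1) \<open>l < u\<close> ab b1 e by auto
    then have "Y u \<le> Y a" "X ?v \<le> X b"
      using mono_onD[OF \<nu>.mono_on_quantile, of u a] mono_onD[OF \<mu>.mono_on_quantile, of ?v b] u ab b1 by auto
    ultimately show "X ?v - Y ?v < X u - Y u" using e e3 by linarith
  qed
qed

lemma weak_transport_cost_less_monotone_cost:
  assumes strict: "strictly_convex \<theta>" and \<theta>: "\<And>t. 0 \<le> \<theta> t" "\<And>t. \<theta> (- t) = \<theta> t"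
    and \<theta>m [measurable]: "\<theta> \<in> borel_measurable borel"
    and atom: "\<And>x. measure \<mu> {x} = 0"
    and fin: "monotone_cost \<theta> < \<infinity>"
    and nmono: "\<not> mono_on {0<..<1} (\<lambda>u. X u - Y u)"
  shows "weak_transport_cost \<theta> \<nu> \<mu> < monotone_cost \<theta>"
proof -
  obtain a b where ab: "0 < a" "a \<le> b" "b < 1" "X b - Y b < X a - Y a"
    using nmono by (auto simp: mono_on_def not_le)
  obtain \<delta> where \<delta>: "0 < \<delta>" "\<delta> \<le> b - a" "\<delta> \<le> a"
    and drop: "\<And>u. a - \<delta> < u \<Longrightarrow> u \<le> a \<Longrightarrow> X (u + (b - a)) - Y (u + (b - a)) < X u - Y u"
    using drop_on_intervals[OF ab] by blast
  define \<sigma> where "\<sigma> = interval_swap a b \<delta>"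
  have [measurable]: "\<sigma> \<in> borel_measurable borel" unfolding \<sigma>_def by (rule interval_swap_measurable)
  have \<sigma>01: "0 < \<sigma> u \<and> \<sigma> u < 1" if "0 < u" "u < 1" for u
    using that \<delta> ab by (auto simp: \<sigma>_def interval_swap_def)
  have \<sigma>\<sigma>: "\<sigma> (\<sigma> u) = u" for u using \<delta> by (auto simp: \<sigma>_def interval_swap_def)
  have pres: "(\<integral>\<^sup>+u. h (\<sigma> u) \<partial>U01) = (\<integral>\<^sup>+u. h u \<partial>U01)" if "h \<in> borel_measurable borel" for h
    unfolding \<sigma>_def by (rule nn_integral_interval_swap) (use \<delta> ab that in auto)
  obtain X' where [measurable]: "X' \<in> borel_measurable borel" and X': "\<forall>u\<in>{0<..<1}. X' u = X u"
    by (rule \<mu>.quantile_borel_extension)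
  obtain Y' where Ym [measurable]: "Y' \<in> borel_measurable borel" and Y': "\<forall>u\<in>{0<..<1}. Y' u = Y u"
    by (rule \<nu>.quantile_borel_extension)
  have [measurable]: "(\<lambda>u. u) \<in> borel_measurable U01" by (rule measurable_restrict_space1) simp
  define d where "d u = X' u - Y' u" for u
  have [measurable]: "d \<in> borel_measurable borel" unfolding d_def by measurable
  have dXY: "d u = X u - Y u" if "0 < u" "u < 1" for u using that by (simp add: d_def X' Y')
  \<comment> \<open>Outside the two intervals \<open>\<sigma> u = u\<close>, and the junk value \<open>0 / 0 = 0\<close> is the right one.\<close>
  define t where "t u = (d u - d (\<sigma> u)) / (2 * (Y' (\<sigma> u) - Y' u))" for u
  have tm: "t \<in> borel_measurable borel" unfolding t_def by measurable
  have t\<sigma>: "t (\<sigma> u) = t u" for u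
    unfolding t_def \<sigma>\<sigma> by (metis (no_types, opaque_lifting) minus_diff_eq minus_divide_divide mult_minus_right)
  \<comment> \<open>The second inequality amounts to \<open>X u \<le> X (\<sigma> u)\<close>; it
    makes the weight \<open>t u\<close> at most \<open>1\<close>.\<close>
  have low: "d (\<sigma> u) < d u \<and> d u - d (\<sigma> u) \<le> Y' (\<sigma> u) - Y' u" if "a - \<delta> < u" "u \<le> a" for u
  proof -
    have s: "\<sigma> u = u + (b - a)" using that by (simp add: \<sigma>_def interval_swap_def)
    have u: "0 < u" "u < 1" "0 < u + (b - a)" "u + (b - a) < 1" using that \<delta> ab by auto
    have "X u \<le> X (u + (b - a))"
      using mono_onD[OF \<mu>.mono_on_quantile, of u "u + (b - a)"] u ab by auto
    then show ?thesis using drop[OF that] u unfolding s by (simp add: dXY Y')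
  qed
  \<comment> \<open>A point \<open>u\<close> of the second interval is treated through
    \<open>\<sigma> u\<close> in the first, since \<open>t\<close> is invariant under
    \<open>\<sigma>\<close>.\<close>
  have cases: "\<sigma> u = u \<or> (a - \<delta> < u \<and> u \<le> a) \<or> (a - \<delta> < \<sigma> u \<and> \<sigma> u \<le> a)" for u
    by (auto simp: \<sigma>_def interval_swap_def)
  have t1: "0 \<le> t u \<and> t u \<le> 1" and td: "t u * (Y' (\<sigma> u) - Y' u) = (d u - d (\<sigma> u)) / 2" for u
  proof -
    have *: "0 \<le> t u \<and> t u \<le> 1 \<and> t u * (Y' (\<sigma> u) - Y' u) = (d u - d (\<sigma> u)) / 2" if "a - \<delta> < u" "u \<le> a" for u
      using low[OF that] by (auto simp: t_def field_simps)
    show "0 \<le> t u \<and> t u \<le> 1" using cases[of u] *[of u] *[of "\<sigma> u"] by (auto simp: t\<sigma>) (auto simp: t_def)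
    show "t u * (Y' (\<sigma> u) - Y' u) = (d u - d (\<sigma> u)) / 2"
      using cases[of u]
    proof (elim disjE)
      assume "\<sigma> u = u" then show ?thesis by simp
    next
      assume "a - \<delta> < \<sigma> u \<and> \<sigma> u \<le> a"
      then have "t u * (Y' u - Y' (\<sigma> u)) = (d (\<sigma> u) - d u) / 2"
        using *[of "\<sigma> u"] by (simp add: t\<sigma> \<sigma>\<sigma>)
      then show ?thesis by (simp add: algebra_simps diff_divide_distrib)
    qed (use * in blast)
  qed
  \<comment> \<open>Since \<open>\<sigma>\<close> preserves \<open>U01\<close>, averaging the cost
    over \<open>u\<close> and \<open>\<sigma> u\<close> does not change the integral.\<close>
  have "(\<integral>\<^sup>+u. ennreal (\<theta> (d u) / 2) + ennreal (\<theta> (d (\<sigma> u)) / 2) \<partial>U01) = (\<integral>\<^sup>+u. ennreal (\<theta> (d u) / 2) \<partial>U01) + (\<integral>\<^sup>+u. ennreal (\<theta> (d (\<sigma> u)) / 2) \<partial>U01)"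
    by (rule nn_integral_add) measurable
  also have "\<dots> = (\<integral>\<^sup>+u. ennreal (\<theta> (d u) / 2) \<partial>U01) + (\<integral>\<^sup>+u. ennreal (\<theta> (d u) / 2) \<partial>U01)"
    by (subst pres[of "\<lambda>u. ennreal (\<theta> (d u) / 2)"]) simp_all
  also have "\<dots> = (\<integral>\<^sup>+u. ennreal (\<theta> (d u) / 2) + ennreal (\<theta> (d u) / 2) \<partial>U01)"
    by (rule nn_integral_add[symmetric]) measurable
  also have "\<dots> = monotone_cost \<theta>"
    by (rule nn_integral_cong)
       (use \<theta>(1) in \<open>auto simp: space_restrict_space dXY ennreal_plus[symmetric] simp del: ennreal_plus\<close>)
  finally have B_eq: "(\<integral>\<^sup>+u. ennreal (\<theta> (d u) / 2) + ennreal (\<theta> (d (\<sigma> u)) / 2) \<partial>U01) = monotone_cost \<theta>" .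
  have "weak_transport_cost \<theta> \<nu> \<mu> \<le> (\<integral>\<^sup>+u. ennreal (\<theta> (X u - (t u * Y (\<sigma> u) + (1 - t u) * Y u))) \<partial>U01)"
    by (rule weak_transport_cost_le_swap[OF \<theta>(2) \<theta>m atom _ \<sigma>01 pres Ym _ tm]) (use t1 t\<sigma> Y' in auto)
  also have "\<dots> = (\<integral>\<^sup>+u. ennreal (\<theta> ((d u + d (\<sigma> u)) / 2)) \<partial>U01)"
  proof (rule nn_integral_cong)
    fix u assume "u \<in> space U01"
    then have u: "0 < u" "u < 1" by (auto simp: space_restrict_space)
    have "X u - (t u * Y (\<sigma> u) + (1 - t u) * Y u) = d u - t u * (Y' (\<sigma> u) - Y' u)"
      using u \<sigma>01[OF u] by (simp add: dXY Y' algebra_simps)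
    also have "\<dots> = (d u + d (\<sigma> u)) / 2" unfolding td by (simp add: field_simps)
    finally show "ennreal (\<theta> (X u - (t u * Y (\<sigma> u) + (1 - t u) * Y u))) = ennreal (\<theta> ((d u + d (\<sigma> u)) / 2))" by (simp only:)
  qed
  also have "\<dots> < (\<integral>\<^sup>+u. ennreal (\<theta> (d u) / 2) + ennreal (\<theta> (d (\<sigma> u)) / 2) \<partial>U01)"
    (is "?A < ?B")
  proof (rule nn_integral_less)
    have le: "\<theta> ((x + y) / 2) \<le> (\<theta> x + \<theta> y) / 2" for x y
      using strictly_convex_midpoint[OF strict, of x y] by (cases "x = y") auto
    have sum: "ennreal (\<theta> x / 2) + ennreal (\<theta> y / 2) = ennreal ((\<theta> x + \<theta> y) / 2)" for x y
      using \<theta>(1) by (simp add: ennreal_plus[symmetric] add_divide_distrib del: ennreal_plus)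
    show AE: "AE u in U01. ennreal (\<theta> ((d u + d (\<sigma> u)) / 2)) \<le> ennreal (\<theta> (d u) / 2) + ennreal (\<theta> (d (\<sigma> u)) / 2)"
      unfolding sum by (intro AE_I2 ennreal_leI le)
    \<comment> \<open>Strictness of the integral inequality needs a finite smaller side, which
      \<open>fin\<close> provides.\<close>
    show "?A \<noteq> \<infinity>"
      using nn_integral_mono_AE[OF AE] fin unfolding B_eq by auto
    show "\<not> (AE u in U01. ennreal (\<theta> (d u) / 2) + ennreal (\<theta> (d (\<sigma> u)) / 2) \<le> ennreal (\<theta> ((d u + d (\<sigma> u)) / 2)))"
    proof
      assume "AE u in U01. ennreal (\<theta> (d u) / 2) + ennreal (\<theta> (d (\<sigma> u)) / 2) \<le> ennreal (\<theta> ((d u + d (\<sigma> u)) / 2))"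
      \<comment> \<open>Equality forces \<open>d u = d (\<sigma> u)\<close>, so an interval of
        length \<open>\<delta>\<close> would be null.\<close>
      then have "AE u in U01. \<not> (a - \<delta> < u \<and> u \<le> a)"
      proof eventually_elim
        case (elim u)
        show ?case
        proof
          assume "a - \<delta> < u \<and> u \<le> a"
          then have "d u \<noteq> d (\<sigma> u)" using low[of u] by auto
          from strictly_convex_midpoint[OF strict this] elim \<theta>(1) show False
            unfolding sum by (simp add: ennreal_le_iff2) (smt (verit))
        qed
      qed
      then have "emeasure U01 {a - \<delta><..a} = 0"
        by (subst (asm) AE_iff_measurable[of "{a - \<delta><..a}"])
           (use \<delta> ab in \<open>auto simp: space_restrict_space sets_restrict_space_iff\<close>)
      then show False
        using \<delta> ab by (subst (asm) emeasure_restrict_space) (auto simp: ennreal_eq_0_iff)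
    qed
  qed measurable
  also note B_eq
  finally show ?thesis .
qed

text \<open>The degenerate exchange, with \<open>\<sigma>\<close> the identity and weight
  \<open>0\<close>, is the monotone coupling.\<close>

lemma weak_transport_cost_le_monotone_cost:
  assumes even: "\<And>t. \<theta> (- t) = \<theta> t" and \<theta>m: "\<theta> \<in> borel_measurable borel"
    and atom: "\<And>x. measure \<mu> {x} = 0"
  shows "weak_transport_cost \<theta> \<nu> \<mu> \<le> monotone_cost \<theta>"
proof -
  obtain Y' where Y': "Y' \<in> borel_measurable borel" "\<forall>u\<in>{0<..<1}. Y' u = Y u"
    by (rule \<nu>.quantile_borel_extension)
  have "weak_transport_cost \<theta> \<nu> \<mu> \<le> (\<integral>\<^sup>+u. ennreal (\<theta> (X u - (0 * Y u + (1 - 0) * Y u))) \<partial>U01)"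
    by (rule weak_transport_cost_le_swap[OF even \<theta>m atom, where \<sigma> = "\<lambda>u. u" and t = "\<lambda>_. 0" and Y' = Y']) (use Y' in auto)
  then show ?thesis by simp
qed

end

theorem theorem2p2:
  fixes \<mu> \<nu> :: "real measure" and \<theta> :: "real \<Rightarrow> real"
  assumes "prob_fm \<mu>" and "prob_fm \<nu>"
    and "absolutely_continuous lborel \<mu>" and "absolutely_continuous lborel \<nu>"
    and "cost_function \<theta>" and "strictly_convex \<theta>"
    and "\<exists>p \<in> coupling_kernels \<mu> \<nu>. weak_cost_of \<theta> \<mu> p < \<infinity>"
  shows "weak_transport_cost \<theta> \<nu> \<mu> = transport_cost \<theta> \<mu> \<nu> \<longleftrightarrow>
         mono_on {0<..<1} (\<lambda>u. quantile \<mu> u - quantile \<nu> u)"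
proof -
  interpret two_laws \<mu> \<nu> using assms(1,2) by unfold_locales
  have \<theta>: "\<And>t. 0 \<le> \<theta> t" "\<theta> 0 = 0" "\<And>t. \<theta> (- t) = \<theta> t" and conv: "convex_on UNIV \<theta>"
    using assms(5) by (auto simp: cost_function_def)
  obtain g where sg: "subgradient \<theta> g" using convex_on_UNIV_subgradient_exists[OF conv] .
  have \<theta>m: "\<theta> \<in> borel_measurable borel"
    by (intro borel_measurable_continuous_onI convex_on_continuous conv) auto
  \<comment> \<open>Absolute continuity of \<open>\<mu>\<close> enters through the absence of
    atoms.\<close>
  have atom: "measure \<mu> {x} = 0" for x
  proof -
    have "{x} \<in> null_sets lborel" by (simp add: null_sets_def)
    then have "{x} \<in> null_sets \<mu>" using assms(3) unfolding absolutely_continuous_def by blast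
    then show ?thesis by (auto simp: measure_def)
  qed
  have T: "transport_cost \<theta> \<mu> \<nu> = monotone_cost \<theta>"
    using sg \<theta> \<theta>m by (rule transport_cost_eq_monotone_cost)
  show ?thesis
  proof
    assume "mono_on {0<..<1} (\<lambda>u. X u - Y u)"
    then show "weak_transport_cost \<theta> \<nu> \<mu> = transport_cost \<theta> \<mu> \<nu>"
      unfolding T using monotone_cost_le_weak_transport_cost[OF sg \<theta> \<theta>m]
        weak_transport_cost_le_monotone_cost[OF \<theta>(3) \<theta>m atom] by (auto intro: antisym)
  next
    assume eq: "weak_transport_cost \<theta> \<nu> \<mu> = transport_cost \<theta> \<mu> \<nu>"
    \<comment> \<open>The assumed finite coupling bounds the weak cost, and \<open>eq\<close>
      carries finiteness over to the monotone cost; a failure of monotonicity would then contradict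
      \<open>eq\<close>.\<close>
    have "weak_transport_cost \<theta> \<nu> \<mu> < \<infinity>"
      using assms(7) by (auto simp: weak_transport_cost_def INF_less_iff)
    then have "monotone_cost \<theta> < \<infinity>" using eq T by simp
    then show "mono_on {0<..<1} (\<lambda>u. X u - Y u)"
      using weak_transport_cost_less_monotone_cost[OF assms(6) \<theta>(1,3) \<theta>m atom] eq T by force
  qed
qed

end
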